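(* Let $\mathscr{D}$ be a derivator and let $S$ be a (small) discrete category. A cocone $X\in\mathscr{D}(S^\rhd)$ is a coproduct cocone if and only if the underlying diagram $\mathrm{dia}_{S^\rhd}(X)\colon S^\rhd\to\mathscr{D}(\mathbb{1})$ is a coproduct cocone, i.e., it exhibits $X_\infty$ as the (categorical) coproduct of the objects $X_s\in\mathscr{D}(\mathbb{1})$, $s\in S$.
   Context: **Derivators.** $\mathbf{Cat}$ is the 2-category of small categories, $\mathbf{CAT}$ that of not necessarily small categories, $\mathbb{1}$ is the terminal category, $\pi_A\colon A\to\mathbb{1}$ the unique functor; objects $a\in A$ are identified with functors $a\colon\mathbb{1}\to A$. A prederivator is a strict 2-functor $\mathscr{D}\colon\mathbf{Cat}^{\mathrm{op}}\to\mathbf{CAT}$ (op reverses functors only); $u\colon A\to B$ induces $u^\ast\colon\mathscr{D}(B)\to\mathscr{D}(A)$, and $X_a:=a^\ast X$. It is a derivator if: (Der1) $\mathscr{D}$ sends coproducts to products; (Der2) $f$ in $\mathscr{D}(A)$ is an isomorphism iff $f_a$ is so for all $a\in A$; (Der3) each $u^\ast$ has a left adjoint $u_!$ and a right adjoint $u_\ast$ (write $\operatorname{colim}_A=(\pi_A)_!$, $\lim_A=(\pi_A)_\ast$); (Der4) for $u\colon A\to B$, $b\in B$, with projections $p\colon(u/b)\to A$, $q\colon(b/u)\to A$ from the slice categories, the canonical mates $\operatorname{colim}_{(u/b)}p^\ast\to b^\ast u_!$ and $b^\ast u_\ast\to\lim_{(b/u)}q^\ast$ are isomorphisms. The underlying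 diagram of $X\in\mathscr{D}(A)$ is the functor $\mathrm{dia}_A(X)\colon A\to\mathscr{D}(\mathbb{1})$, $a\mapsto X_a$. For a small category $A$, the cocone $A^\rhd$ is obtained from $A$ by adjoining a new final object $\infty$; $i_A\colon A\to A^\rhd$ is the inclusion. A cocone in $\mathscr{D}$ with shape $A$ is an object $X\in\mathscr{D}(A^\rhd)$; it is colimiting if it lies in the essential image of $(i_A)_!\colon\mathscr{D}(A)\to\mathscr{D}(A^\rhd)$. For discrete $A=S$ a colimiting cocone is called a coproduct cocone. *)

theory Defs
  imports Main "HOL-Library.FuncSet" "HOL-Library.Equipollence"
begin

section \<open>Universes\<close>

text \<open>
  Smallness is relative to a Grothendieck universe, represented by a type \<open>'u\<close> which plays the
  role of the set of all small sets: a set is small when it has strictly fewer elements than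
  \<open>'u\<close>. The axioms say that the cardinality of \<open>'u\<close> is an infinite regular strong limit, i.e. the
  cardinality of a nonempty Grothendieck universe (as in SGA 4, the universe of hereditarily
  finite sets is not excluded; it is the instance \<open>nat\<close> below). Up to isomorphism every small
  category has its objects and its arrows in \<open>'u\<close>.
\<close>

definition small :: "'u set \<Rightarrow> bool" where
  "small A \<longleftrightarrow> A \<prec> (UNIV :: 'u set)"

class universe =
  assumes infinite_universe: "infinite (UNIV :: 'a set)"
    and small_Union: "\<And>(I :: 'a set) (F :: 'a \<Rightarrow> 'a set).
      small I \<Longrightarrow> (\<And>i. i \<in> I \<Longrightarrow> small (F i)) \<Longrightarrow> small (\<Union>i\<in>I. F i)"
    and small_Pow: "\<And>A :: 'a set. small A \<Longrightarrow> Pow A \<prec> (UNIV :: 'a set)"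

lemma small_nat_iff: "small (A :: nat set) \<longleftrightarrow> finite A"
proof
  assume A: "small A"
  show "finite A"
  proof (rule ccontr)
    assume "infinite A"
    then have "(UNIV :: nat set) \<lesssim> A" by (simp add: infinite_le_lepoll)
    then have "(UNIV :: nat set) \<prec> (UNIV :: nat set)"
      using A unfolding small_def by (rule lesspoll_trans1)
    then show False by simp
  qed
qed (simp add: small_def finite_lesspoll_infinite)

instance nat :: universe
proof
  fix A :: "nat set"
  assume "small A"
  then have "finite (Pow A)" by (simp add: small_nat_iff)
  then show "Pow A \<prec> (UNIV :: nat set)" by (simp add: finite_lesspoll_infinite)
qed (auto simp: small_nat_iff)

text \<open>
  Constructions on small categories naturally live over types built from \<open>'u\<close>; \<open>code\<close> moves them
  back into \<open>'u\<close> along a fixed injection, which exists for every type used below.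
\<close>

definition code :: "'a \<Rightarrow> 'u :: universe" where
  "code = (SOME e. inj e)"

definition decode :: "'u :: universe \<Rightarrow> 'a" where
  "decode = inv code"

lemma inj_code:
  fixes e :: "'a \<Rightarrow> 'u :: universe"
  assumes "inj e"
  shows "inj (code :: 'a \<Rightarrow> 'u)"
  unfolding code_def using assms by (rule someI[of inj])

lemma ex_inj_pair: "\<exists>e :: 'u :: universe \<times> 'u \<Rightarrow> 'u. inj e"
proof -
  have "( card_of ((UNIV :: 'u set) \<times> (UNIV :: 'u set)), card_of (UNIV :: 'u set) ) \<in> ordLeq"
    by (rule ordIso_imp_ordLeq[OF card_of_Times_same_infinite[OF infinite_universe]])
  then have "\<exists>e. inj_on e ((UNIV :: 'u set) \<times> (UNIV :: 'u set)) \<and>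
      e ` ((UNIV :: 'u set) \<times> (UNIV :: 'u set)) \<subseteq> (UNIV :: 'u set)"
    by (simp only: card_of_ordLeq)
  then show ?thesis by auto
qed

lemma inj_code_unit: "inj (code :: unit \<Rightarrow> 'u :: universe)"
  by (rule inj_code[of "\<lambda>_. undefined"]) (simp add: inj_def)

lemma inj_code_pair: "inj (code :: 'u \<times> 'u \<Rightarrow> 'u :: universe)"
  using ex_inj_pair inj_code by blast

lemma inj_code_triple: "inj (code :: ('u \<times> 'u) \<times> 'u \<times> ('u \<times> 'u) \<Rightarrow> 'u :: universe)"
proof -
  obtain e :: "'u \<times> 'u \<Rightarrow> 'u" where e: "inj e"
    using ex_inj_pair by blast
  have "inj (\<lambda>(x, h, y). e (e x, e (h, e y)))"
    by (intro injI) (auto simp: inj_eq[OF e])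
  then show ?thesis by (rule inj_code)
qed

lemma ex_neq_universe: "\<exists>a b :: 'u :: universe. a \<noteq> b"
proof (rule ccontr)
  assume "\<not> ?thesis"
  then have "(UNIV :: 'u set) = {undefined}" by auto
  then have "finite (UNIV :: 'u set)" by (metis finite.emptyI finite.insertI)
  with infinite_universe show False by blast
qed

lemma inj_code_option: "inj (code :: 'u option \<Rightarrow> 'u :: universe)"
proof -
  obtain e :: "'u \<times> 'u \<Rightarrow> 'u" where e: "inj e"
    using ex_inj_pair by blast
  obtain a b :: 'u where "a \<noteq> b"
    using ex_neq_universe by blast
  then have "inj (\<lambda>z. case z of None \<Rightarrow> e (a, a) | Some x \<Rightarrow> e (b, x))"
    by (intro injI) (auto simp: inj_eq[OF e] split: option.splits)
  then show ?thesis by (rule inj_code)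
qed

section \<open>Categories\<close>

text \<open>
  All structure maps are required to be \<open>undefined\<close> outside their proper domain, so that equality
  of records is equality of categories, functors and natural transformations. The composite
  \<open>Comp C g f\<close> is \<open>g\<close> after \<open>f\<close>.
\<close>

record ('o, 'a) cat =
  Obj :: "'o set"
  Arr :: "'a set"
  Dom :: "'a \<Rightarrow> 'o"
  Cod :: "'a \<Rightarrow> 'o"
  Id :: "'o \<Rightarrow> 'a"
  Comp :: "'a \<Rightarrow> 'a \<Rightarrow> 'a"

definition Hom :: "('o, 'a) cat \<Rightarrow> 'o \<Rightarrow> 'o \<Rightarrow> 'a set" where
  "Hom C x y = {f \<in> Arr C. Dom C f = x \<and> Cod C f = y}"

definition composable :: "('o, 'a) cat \<Rightarrow> 'a \<Rightarrow> 'a \<Rightarrow> bool" where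
  "composable C g f \<longleftrightarrow> g \<in> Arr C \<and> f \<in> Arr C \<and> Dom C g = Cod C f"

definition category :: "('o, 'a) cat \<Rightarrow> bool" where
  "category C \<longleftrightarrow>
    Dom C \<in> Arr C \<rightarrow>\<^sub>E Obj C \<and>
    Cod C \<in> Arr C \<rightarrow>\<^sub>E Obj C \<and>
    Id C \<in> Obj C \<rightarrow>\<^sub>E Arr C \<and>
    (\<forall>x\<in>Obj C. Id C x \<in> Hom C x x) \<and>
    (\<forall>g f. composable C g f \<longrightarrow> Comp C g f \<in> Hom C (Dom C f) (Cod C g)) \<and>
    (\<forall>g f. \<not> composable C g f \<longrightarrow> Comp C g f = undefined) \<and>
    (\<forall>f\<in>Arr C. Comp C f (Id C (Dom C f)) = f \<and> Comp C (Id C (Cod C f)) f = f) \<and>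
    (\<forall>h g f. composable C h g \<and> composable C g f \<longrightarrow>
      Comp C (Comp C h g) f = Comp C h (Comp C g f))"

definition iso_arr :: "('o, 'a) cat \<Rightarrow> 'a \<Rightarrow> bool" where
  "iso_arr C f \<longleftrightarrow> f \<in> Arr C \<and>
    (\<exists>g\<in>Hom C (Cod C f) (Dom C f).
      Comp C g f = Id C (Dom C f) \<and> Comp C f g = Id C (Cod C f))"

definition isomorphic :: "('o, 'a) cat \<Rightarrow> 'o \<Rightarrow> 'o \<Rightarrow> bool" where
  "isomorphic C x y \<longleftrightarrow> (\<exists>f\<in>Hom C x y. iso_arr C f)"

definition discrete :: "('o, 'a) cat \<Rightarrow> bool" where
  "discrete C \<longleftrightarrow> (\<forall>f\<in>Arr C. f = Id C (Dom C f))"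

definition is_coproduct ::
    "('o, 'a) cat \<Rightarrow> 'i set \<Rightarrow> ('i \<Rightarrow> 'o) \<Rightarrow> 'o \<Rightarrow> ('i \<Rightarrow> 'a) \<Rightarrow> bool" where
  "is_coproduct C I x c \<iota> \<longleftrightarrow>
    (\<forall>i\<in>I. x i \<in> Obj C) \<and> c \<in> Obj C \<and> (\<forall>i\<in>I. \<iota> i \<in> Hom C (x i) c) \<and>
    (\<forall>y\<in>Obj C. \<forall>f. (\<forall>i\<in>I. f i \<in> Hom C (x i) y) \<longrightarrow>
      (\<exists>!h. h \<in> Hom C c y \<and> (\<forall>i\<in>I. Comp C h (\<iota> i) = f i)))"

section \<open>Functors\<close>

record ('o, 'a, 'p, 'b) funct =
  Src :: "('o, 'a) cat"
  Tgt :: "('p, 'b) cat"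
  OMap :: "'o \<Rightarrow> 'p"
  AMap :: "'a \<Rightarrow> 'b"

definition is_functor :: "('o, 'a, 'p, 'b) funct \<Rightarrow> bool" where
  "is_functor F \<longleftrightarrow>
    category (Src F) \<and> category (Tgt F) \<and>
    OMap F \<in> Obj (Src F) \<rightarrow>\<^sub>E Obj (Tgt F) \<and>
    AMap F \<in> Arr (Src F) \<rightarrow>\<^sub>E Arr (Tgt F) \<and>
    (\<forall>f\<in>Arr (Src F). Dom (Tgt F) (AMap F f) = OMap F (Dom (Src F) f) \<and>
      Cod (Tgt F) (AMap F f) = OMap F (Cod (Src F) f)) \<and>
    (\<forall>x\<in>Obj (Src F). AMap F (Id (Src F) x) = Id (Tgt F) (OMap F x)) \<and>
    (\<forall>g f. composable (Src F) g f \<longrightarrow>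
      AMap F (Comp (Src F) g f) = Comp (Tgt F) (AMap F g) (AMap F f))"

definition functor_from_to ::
    "('o, 'a, 'p, 'b) funct \<Rightarrow> ('o, 'a) cat \<Rightarrow> ('p, 'b) cat \<Rightarrow> bool" where
  "functor_from_to F C D \<longleftrightarrow> is_functor F \<and> Src F = C \<and> Tgt F = D"

definition id_funct :: "('o, 'a) cat \<Rightarrow> ('o, 'a, 'o, 'a) funct" where
  "id_funct C =
    \<lparr>Src = C, Tgt = C, OMap = restrict (\<lambda>x. x) (Obj C), AMap = restrict (\<lambda>f. f) (Arr C)\<rparr>"

definition comp_funct ::
    "('p, 'b, 'q, 'c) funct \<Rightarrow> ('o, 'a, 'p, 'b) funct \<Rightarrow> ('o, 'a, 'q, 'c) funct"
    (infixl "\<circ>\<^sub>F" 70) where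
  "G \<circ>\<^sub>F F =
    \<lparr>Src = Src F, Tgt = Tgt G,
     OMap = restrict (\<lambda>x. OMap G (OMap F x)) (Obj (Src F)),
     AMap = restrict (\<lambda>f. AMap G (AMap F f)) (Arr (Src F))\<rparr>"

section \<open>Natural transformations\<close>

record ('o, 'a, 'p, 'b) ntrans =
  NSrc :: "('o, 'a, 'p, 'b) funct"
  NTgt :: "('o, 'a, 'p, 'b) funct"
  Cmp :: "'o \<Rightarrow> 'b"

definition is_ntrans :: "('o, 'a, 'p, 'b) ntrans \<Rightarrow> bool" where
  "is_ntrans \<alpha> \<longleftrightarrow>
    is_functor (NSrc \<alpha>) \<and> is_functor (NTgt \<alpha>) \<and>
    Src (NSrc \<alpha>) = Src (NTgt \<alpha>) \<and> Tgt (NSrc \<alpha>) = Tgt (NTgt \<alpha>) \<and>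
    Cmp \<alpha> \<in> extensional (Obj (Src (NSrc \<alpha>))) \<and>
    (\<forall>x\<in>Obj (Src (NSrc \<alpha>)).
      Cmp \<alpha> x \<in> Hom (Tgt (NSrc \<alpha>)) (OMap (NSrc \<alpha>) x) (OMap (NTgt \<alpha>) x)) \<and>
    (\<forall>f\<in>Arr (Src (NSrc \<alpha>)).
      Comp (Tgt (NSrc \<alpha>)) (AMap (NTgt \<alpha>) f) (Cmp \<alpha> (Dom (Src (NSrc \<alpha>)) f)) =
      Comp (Tgt (NSrc \<alpha>)) (Cmp \<alpha> (Cod (Src (NSrc \<alpha>)) f)) (AMap (NSrc \<alpha>) f))"

definition ntrans_from_to ::
    "('o, 'a, 'p, 'b) ntrans \<Rightarrow> ('o, 'a, 'p, 'b) funct \<Rightarrow> ('o, 'a, 'p, 'b) funct \<Rightarrow> bool" where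
  "ntrans_from_to \<alpha> F G \<longleftrightarrow> is_ntrans \<alpha> \<and> NSrc \<alpha> = F \<and> NTgt \<alpha> = G"

definition is_niso :: "('o, 'a, 'p, 'b) ntrans \<Rightarrow> bool" where
  "is_niso \<alpha> \<longleftrightarrow>
    is_ntrans \<alpha> \<and> (\<forall>x\<in>Obj (Src (NSrc \<alpha>)). iso_arr (Tgt (NSrc \<alpha>)) (Cmp \<alpha> x))"

definition id_ntrans :: "('o, 'a, 'p, 'b) funct \<Rightarrow> ('o, 'a, 'p, 'b) ntrans" where
  "id_ntrans F =
    \<lparr>NSrc = F, NTgt = F, Cmp = (\<lambda>x\<in>Obj (Src F). Id (Tgt F) (OMap F x))\<rparr>"

text \<open>Vertical and horizontal composition; in both cases the right argument comes first.\<close>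

definition vcomp ::
    "('o, 'a, 'p, 'b) ntrans \<Rightarrow> ('o, 'a, 'p, 'b) ntrans \<Rightarrow> ('o, 'a, 'p, 'b) ntrans" where
  "vcomp \<beta> \<alpha> =
    \<lparr>NSrc = NSrc \<alpha>, NTgt = NTgt \<beta>,
     Cmp = (\<lambda>x\<in>Obj (Src (NSrc \<alpha>)). Comp (Tgt (NSrc \<alpha>)) (Cmp \<beta> x) (Cmp \<alpha> x))\<rparr>"

definition hcomp ::
    "('p, 'b, 'q, 'c) ntrans \<Rightarrow> ('o, 'a, 'p, 'b) ntrans \<Rightarrow> ('o, 'a, 'q, 'c) ntrans" where
  "hcomp \<beta> \<alpha> =
    \<lparr>NSrc = NSrc \<beta> \<circ>\<^sub>F NSrc \<alpha>, NTgt = NTgt \<beta> \<circ>\<^sub>F NTgt \<alpha>,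
     Cmp = (\<lambda>x\<in>Obj (Src (NSrc \<alpha>)).
       Comp (Tgt (NSrc \<beta>)) (Cmp \<beta> (OMap (NTgt \<alpha>) x)) (AMap (NSrc \<beta>) (Cmp \<alpha> x)))\<rparr>"

definition lwhisk ::
    "('p, 'b, 'q, 'c) funct \<Rightarrow> ('o, 'a, 'p, 'b) ntrans \<Rightarrow> ('o, 'a, 'q, 'c) ntrans" where
  "lwhisk G \<alpha> =
    \<lparr>NSrc = G \<circ>\<^sub>F NSrc \<alpha>, NTgt = G \<circ>\<^sub>F NTgt \<alpha>,
     Cmp = (\<lambda>x\<in>Obj (Src (NSrc \<alpha>)). AMap G (Cmp \<alpha> x))\<rparr>"

definition rwhisk ::
    "('p, 'b, 'q, 'c) ntrans \<Rightarrow> ('o, 'a, 'p, 'b) funct \<Rightarrow> ('o, 'a, 'q, 'c) ntrans" where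
  "rwhisk \<beta> F =
    \<lparr>NSrc = NSrc \<beta> \<circ>\<^sub>F F, NTgt = NTgt \<beta> \<circ>\<^sub>F F,
     Cmp = (\<lambda>x\<in>Obj (Src F). Cmp \<beta> (OMap F x))\<rparr>"

section \<open>Equivalences and adjunctions\<close>

definition is_equivalence :: "('o, 'a, 'p, 'b) funct \<Rightarrow> bool" where
  "is_equivalence F \<longleftrightarrow> is_functor F \<and>
    (\<exists>G \<alpha> \<beta>. functor_from_to G (Tgt F) (Src F) \<and>
      ntrans_from_to \<alpha> (id_funct (Src F)) (G \<circ>\<^sub>F F) \<and> is_niso \<alpha> \<and>
      ntrans_from_to \<beta> (F \<circ>\<^sub>F G) (id_funct (Tgt F)) \<and> is_niso \<beta>)"

definition adjunction ::
    "('o, 'a, 'p, 'b) funct \<Rightarrow> ('p, 'b, 'o, 'a) funct \<Rightarrow>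
     ('o, 'a, 'o, 'a) ntrans \<Rightarrow> ('p, 'b, 'p, 'b) ntrans \<Rightarrow> bool" where
  "adjunction L R \<eta> \<epsilon> \<longleftrightarrow>
    is_functor L \<and> functor_from_to R (Tgt L) (Src L) \<and>
    ntrans_from_to \<eta> (id_funct (Src L)) (R \<circ>\<^sub>F L) \<and>
    ntrans_from_to \<epsilon> (L \<circ>\<^sub>F R) (id_funct (Tgt L)) \<and>
    (\<forall>x\<in>Obj (Src L).
      Comp (Tgt L) (Cmp \<epsilon> (OMap L x)) (AMap L (Cmp \<eta> x)) = Id (Tgt L) (OMap L x)) \<and>
    (\<forall>y\<in>Obj (Src R).
      Comp (Tgt R) (AMap R (Cmp \<epsilon> y)) (Cmp \<eta> (OMap R y)) = Id (Tgt R) (OMap R y))"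

definition has_left_adjoint :: "('p, 'b, 'o, 'a) funct \<Rightarrow> bool" where
  "has_left_adjoint R \<longleftrightarrow> (\<exists>L \<eta> \<epsilon>. adjunction L R \<eta> \<epsilon>)"

definition has_right_adjoint :: "('o, 'a, 'p, 'b) funct \<Rightarrow> bool" where
  "has_right_adjoint L \<longleftrightarrow> (\<exists>R \<eta> \<epsilon>. adjunction L R \<eta> \<epsilon>)"

text \<open>A chosen adjoint together with the unit and the counit of the adjunction.\<close>

definition left_adjoint :: "('p, 'b, 'o, 'a) funct \<Rightarrow>
    ('o, 'a, 'p, 'b) funct \<times> ('o, 'a, 'o, 'a) ntrans \<times> ('p, 'b, 'p, 'b) ntrans" where
  "left_adjoint R = (SOME (L, \<eta>, \<epsilon>). adjunction L R \<eta> \<epsilon>)"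

definition right_adjoint :: "('o, 'a, 'p, 'b) funct \<Rightarrow>
    ('p, 'b, 'o, 'a) funct \<times> ('o, 'a, 'o, 'a) ntrans \<times> ('p, 'b, 'p, 'b) ntrans" where
  "right_adjoint L = (SOME (R, \<eta>, \<epsilon>). adjunction L R \<eta> \<epsilon>)"

section \<open>Products of categories\<close>

definition prod_cat :: "'i set \<Rightarrow> ('i \<Rightarrow> ('o, 'a) cat) \<Rightarrow> ('i \<Rightarrow> 'o, 'i \<Rightarrow> 'a) cat" where
  "prod_cat I C =
    \<lparr>Obj = (\<Pi>\<^sub>E i\<in>I. Obj (C i)),
     Arr = (\<Pi>\<^sub>E i\<in>I. Arr (C i)),
     Dom = (\<lambda>f\<in>(\<Pi>\<^sub>E i\<in>I. Arr (C i)). \<lambda>i\<in>I. Dom (C i) (f i)),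
     Cod = (\<lambda>f\<in>(\<Pi>\<^sub>E i\<in>I. Arr (C i)). \<lambda>i\<in>I. Cod (C i) (f i)),
     Id = (\<lambda>x\<in>(\<Pi>\<^sub>E i\<in>I. Obj (C i)). \<lambda>i\<in>I. Id (C i) (x i)),
     Comp = (\<lambda>g f.
       if g \<in> (\<Pi>\<^sub>E i\<in>I. Arr (C i)) \<and> f \<in> (\<Pi>\<^sub>E i\<in>I. Arr (C i)) \<and>
          (\<forall>i\<in>I. Dom (C i) (g i) = Cod (C i) (f i))
       then \<lambda>i\<in>I. Comp (C i) (g i) (f i) else undefined)\<rparr>"

definition tuple_funct ::
    "('o, 'a) cat \<Rightarrow> 'i set \<Rightarrow> ('i \<Rightarrow> ('o, 'a, 'p, 'b) funct) \<Rightarrow>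
     ('o, 'a, 'i \<Rightarrow> 'p, 'i \<Rightarrow> 'b) funct" where
  "tuple_funct C I F =
    \<lparr>Src = C, Tgt = prod_cat I (\<lambda>i. Tgt (F i)),
     OMap = (\<lambda>x\<in>Obj C. \<lambda>i\<in>I. OMap (F i) x),
     AMap = (\<lambda>f\<in>Arr C. \<lambda>i\<in>I. AMap (F i) f)\<rparr>"

section \<open>Small categories\<close>

type_synonym 'u scat = "('u, 'u) cat"
type_synonym 'u sfunct = "('u, 'u, 'u, 'u) funct"
type_synonym 'u sntrans = "('u, 'u, 'u, 'u) ntrans"

definition small_category :: "'u :: universe scat \<Rightarrow> bool" where
  "small_category A \<longleftrightarrow> category A \<and> small (Obj A) \<and> small (Arr A)"

definition small_funct :: "'u :: universe sfunct \<Rightarrow> bool" where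
  "small_funct u \<longleftrightarrow> is_functor u \<and> small_category (Src u) \<and> small_category (Tgt u)"

definition small_ntrans :: "'u :: universe sntrans \<Rightarrow> bool" where
  "small_ntrans \<alpha> \<longleftrightarrow> is_ntrans \<alpha> \<and> small_funct (NSrc \<alpha>) \<and> small_funct (NTgt \<alpha>)"

text \<open>The isomorphic copy inside \<open>'u\<close> of a category living over other types.\<close>

definition encode :: "('o, 'a) cat \<Rightarrow> 'u :: universe scat" where
  "encode C =
    \<lparr>Obj = code ` Obj C,
     Arr = code ` Arr C,
     Dom = (\<lambda>f\<in>code ` Arr C. code (Dom C (decode f))),
     Cod = (\<lambda>f\<in>code ` Arr C. code (Cod C (decode f))),
     Id = (\<lambda>x\<in>code ` Obj C. code (Id C (decode x))),
     Comp = (\<lambda>g f.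
       if g \<in> code ` Arr C \<and> f \<in> code ` Arr C \<and> composable C (decode g) (decode f)
       then code (Comp C (decode g) (decode f)) else undefined)\<rparr>"

subsection \<open>The terminal category\<close>

definition terminal_cat :: "'u :: universe scat" where
  "terminal_cat = encode
    \<lparr>Obj = {()}, Arr = {()}, Dom = (\<lambda>_. ()), Cod = (\<lambda>_. ()), Id = (\<lambda>_. ()), Comp = (\<lambda>_ _. ())\<rparr>"

definition bang :: "'u :: universe scat \<Rightarrow> 'u sfunct" where
  "bang A =
    \<lparr>Src = A, Tgt = terminal_cat, OMap = (\<lambda>x\<in>Obj A. code ()), AMap = (\<lambda>f\<in>Arr A. code ())\<rparr>"

text \<open>An object \<open>a\<close> of \<open>A\<close> as a functor, and an arrow of \<open>A\<close> as a natural transformation.\<close>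

definition pt :: "'u :: universe scat \<Rightarrow> 'u \<Rightarrow> 'u sfunct" where
  "pt A a =
    \<lparr>Src = terminal_cat, Tgt = A,
     OMap = (\<lambda>_\<in>Obj terminal_cat. a), AMap = (\<lambda>_\<in>Arr terminal_cat. Id A a)\<rparr>"

definition pt_arr :: "'u :: universe scat \<Rightarrow> 'u \<Rightarrow> 'u sntrans" where
  "pt_arr A g =
    \<lparr>NSrc = pt A (Dom A g), NTgt = pt A (Cod A g), Cmp = (\<lambda>_\<in>Obj terminal_cat. g)\<rparr>"

subsection \<open>Coproducts of small categories\<close>

definition sum_cat :: "'u :: universe set \<Rightarrow> ('u \<Rightarrow> 'u scat) \<Rightarrow> 'u scat" where
  "sum_cat I A = encode
    \<lparr>Obj = (SIGMA i:I. Obj (A i)),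
     Arr = (SIGMA i:I. Arr (A i)),
     Dom = (\<lambda>(i, f). (i, Dom (A i) f)),
     Cod = (\<lambda>(i, f). (i, Cod (A i) f)),
     Id = (\<lambda>(i, x). (i, Id (A i) x)),
     Comp = (\<lambda>(i, g) (_, f). (i, Comp (A i) g f))\<rparr>"

definition sum_incl :: "'u :: universe set \<Rightarrow> ('u \<Rightarrow> 'u scat) \<Rightarrow> 'u \<Rightarrow> 'u sfunct" where
  "sum_incl I A i =
    \<lparr>Src = A i, Tgt = sum_cat I A,
     OMap = (\<lambda>x\<in>Obj (A i). code (i, x)), AMap = (\<lambda>f\<in>Arr (A i). code (i, f))\<rparr>"

subsection \<open>Slice categories\<close>

text \<open>
  For \<open>u : A \<rightarrow> B\<close> and \<open>b\<close> in \<open>B\<close> the slice \<open>(u/b)\<close> has as objects the pairs \<open>(a, f : u a \<rightarrow> b)\<close>, and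
  an arrow \<open>(a, f) \<rightarrow> (a', f')\<close> is an \<open>h : a \<rightarrow> a'\<close> with \<open>f' \<circ> u h = f\<close>; dually, \<open>(b/u)\<close> has as objects
  the pairs \<open>(a, f : b \<rightarrow> u a)\<close>. Arrows carry their endpoints, as triples \<open>(source, h, target)\<close>.
\<close>

definition slice_obj :: "'u sfunct \<Rightarrow> 'u \<Rightarrow> ('u \<times> 'u) set" where
  "slice_obj u b = {(a, f). a \<in> Obj (Src u) \<and> f \<in> Hom (Tgt u) (OMap u a) b}"

definition slice_arr :: "'u sfunct \<Rightarrow> 'u \<Rightarrow> (('u \<times> 'u) \<times> 'u \<times> ('u \<times> 'u)) set" where
  "slice_arr u b = {((a, f), h, (a', f')).
    (a, f) \<in> slice_obj u b \<and> (a', f') \<in> slice_obj u b \<and>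
    h \<in> Hom (Src u) a a' \<and> Comp (Tgt u) f' (AMap u h) = f}"

definition coslice_obj :: "'u sfunct \<Rightarrow> 'u \<Rightarrow> ('u \<times> 'u) set" where
  "coslice_obj u b = {(a, f). a \<in> Obj (Src u) \<and> f \<in> Hom (Tgt u) b (OMap u a)}"

definition coslice_arr :: "'u sfunct \<Rightarrow> 'u \<Rightarrow> (('u \<times> 'u) \<times> 'u \<times> ('u \<times> 'u)) set" where
  "coslice_arr u b = {((a, f), h, (a', f')).
    (a, f) \<in> coslice_obj u b \<and> (a', f') \<in> coslice_obj u b \<and>
    h \<in> Hom (Src u) a a' \<and> Comp (Tgt u) (AMap u h) f = f'}"

definition triple_cat :: "'u scat \<Rightarrow> ('u \<times> 'u) set \<Rightarrow> (('u \<times> 'u) \<times> 'u \<times> ('u \<times> 'u)) set \<Rightarrow>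
    ('u \<times> 'u, ('u \<times> 'u) \<times> 'u \<times> ('u \<times> 'u)) cat" where
  "triple_cat A obs arrs =
    \<lparr>Obj = obs,
     Arr = arrs,
     Dom = (\<lambda>(x, h, y). x),
     Cod = (\<lambda>(x, h, y). y),
     Id = (\<lambda>(a, f). ((a, f), Id A a, (a, f))),
     Comp = (\<lambda>(_, k, z) (x, h, _). (x, Comp A k h, z))\<rparr>"

definition slice :: "'u :: universe sfunct \<Rightarrow> 'u \<Rightarrow> 'u scat" where
  "slice u b = encode (triple_cat (Src u) (slice_obj u b) (slice_arr u b))"

definition coslice :: "'u :: universe sfunct \<Rightarrow> 'u \<Rightarrow> 'u scat" where
  "coslice u b = encode (triple_cat (Src u) (coslice_obj u b) (coslice_arr u b))"

definition slice_proj :: "'u :: universe sfunct \<Rightarrow> 'u \<Rightarrow> 'u sfunct" where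
  "slice_proj u b =
    \<lparr>Src = slice u b, Tgt = Src u,
     OMap = (\<lambda>z\<in>Obj (slice u b). case decode z of (a, f :: 'u) \<Rightarrow> a),
     AMap = (\<lambda>k\<in>Arr (slice u b).
       case decode k of (x :: 'u \<times> 'u, h, y :: 'u \<times> 'u) \<Rightarrow> h)\<rparr>"

definition coslice_proj :: "'u :: universe sfunct \<Rightarrow> 'u \<Rightarrow> 'u sfunct" where
  "coslice_proj u b =
    \<lparr>Src = coslice u b, Tgt = Src u,
     OMap = (\<lambda>z\<in>Obj (coslice u b). case decode z of (a, f :: 'u) \<Rightarrow> a),
     AMap = (\<lambda>k\<in>Arr (coslice u b).
       case decode k of (x :: 'u \<times> 'u, h, y :: 'u \<times> 'u) \<Rightarrow> h)\<rparr>"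

text \<open>The transformations \<open>u \<circ> p \<Rightarrow> b \<circ> \<pi>\<close> and \<open>b \<circ> \<pi> \<Rightarrow> u \<circ> q\<close> whose component at \<open>(a, f)\<close> is \<open>f\<close>.\<close>

definition slice_cell :: "'u :: universe sfunct \<Rightarrow> 'u \<Rightarrow> 'u sntrans" where
  "slice_cell u b =
    \<lparr>NSrc = u \<circ>\<^sub>F slice_proj u b, NTgt = pt (Tgt u) b \<circ>\<^sub>F bang (slice u b),
     Cmp = (\<lambda>z\<in>Obj (slice u b). case decode z of (a :: 'u, f) \<Rightarrow> f)\<rparr>"

definition coslice_cell :: "'u :: universe sfunct \<Rightarrow> 'u \<Rightarrow> 'u sntrans" where
  "coslice_cell u b =
    \<lparr>NSrc = pt (Tgt u) b \<circ>\<^sub>F bang (coslice u b), NTgt = u \<circ>\<^sub>F coslice_proj u b,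
     Cmp = (\<lambda>z\<in>Obj (coslice u b). case decode z of (a :: 'u, f) \<Rightarrow> f)\<rparr>"

subsection \<open>The cocone of a small category\<close>

text \<open>
  Objects are \<open>Some a\<close> for the objects of \<open>A\<close> and \<open>None\<close> for the new final object; \<open>Leg a\<close> is the
  unique arrow from \<open>a\<close> to it.
\<close>

datatype ('o, 'a) rcone_arr = Base 'a | Leg 'o | Id_infty

lemma inj_code_rcone_arr: "inj (code :: ('u, 'u) rcone_arr \<Rightarrow> 'u :: universe)"
proof -
  obtain e :: "'u \<times> 'u \<Rightarrow> 'u" where e: "inj e"
    using ex_inj_pair by blast
  obtain a b :: 'u where "a \<noteq> b"
    using ex_neq_universe by blast
  then have "inj (\<lambda>k. case k of
      Base f \<Rightarrow> e (a, e (a, f)) | Leg x \<Rightarrow> e (a, e (b, x)) | Id_infty \<Rightarrow> e (b, b))"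
    by (intro injI) (auto simp: inj_eq[OF e] split: rcone_arr.splits)
  then show ?thesis by (rule inj_code)
qed

fun rcone_dom :: "('o, 'a) cat \<Rightarrow> ('o, 'a) rcone_arr \<Rightarrow> 'o option" where
  "rcone_dom A (Base f) = Some (Dom A f)"
| "rcone_dom A (Leg a) = Some a"
| "rcone_dom A Id_infty = None"

fun rcone_cod :: "('o, 'a) cat \<Rightarrow> ('o, 'a) rcone_arr \<Rightarrow> 'o option" where
  "rcone_cod A (Base f) = Some (Cod A f)"
| "rcone_cod A (Leg a) = None"
| "rcone_cod A Id_infty = None"

fun rcone_id :: "('o, 'a) cat \<Rightarrow> 'o option \<Rightarrow> ('o, 'a) rcone_arr" where
  "rcone_id A (Some a) = Base (Id A a)"
| "rcone_id A None = Id_infty"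

fun rcone_comp ::
    "('o, 'a) cat \<Rightarrow> ('o, 'a) rcone_arr \<Rightarrow> ('o, 'a) rcone_arr \<Rightarrow> ('o, 'a) rcone_arr" where
  "rcone_comp A (Base g) (Base f) = Base (Comp A g f)"
| "rcone_comp A (Leg a) (Base f) = Leg (Dom A f)"
| "rcone_comp A Id_infty k = k"
| "rcone_comp A k l = undefined"

definition rcone :: "'u :: universe scat \<Rightarrow> 'u scat" where
  "rcone A = encode
    \<lparr>Obj = insert None (Some ` Obj A),
     Arr = Base ` Arr A \<union> Leg ` Obj A \<union> {Id_infty},
     Dom = rcone_dom A, Cod = rcone_cod A, Id = rcone_id A, Comp = rcone_comp A\<rparr>"

definition rcone_obj :: "'u :: universe \<Rightarrow> 'u" where
  "rcone_obj a = code (Some a)"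

definition rcone_infty :: "'u :: universe" where
  "rcone_infty = code (None :: 'u option)"

definition rcone_leg :: "'u :: universe \<Rightarrow> 'u" where
  "rcone_leg a = code (Leg a :: ('u, 'u) rcone_arr)"

definition rcone_incl :: "'u :: universe scat \<Rightarrow> 'u sfunct" where
  "rcone_incl A =
    \<lparr>Src = A, Tgt = rcone A,
     OMap = (\<lambda>a\<in>Obj A. rcone_obj a),
     AMap = (\<lambda>f\<in>Arr A. code (Base f :: ('u, 'u) rcone_arr))\<rparr>"

section \<open>Prederivators\<close>

text \<open>
  The fields give the values on small categories \<open>A\<close>, on functors \<open>u\<close> (this is \<open>u\<^sup>*\<close>) and on natural
  transformations; the values outside \<open>Cat\<close> are irrelevant. The types \<open>'o\<close> and \<open>'m\<close> are arbitrary, so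
  the categories \<open>D A\<close> need not be small, nor locally small.
\<close>

record ('u, 'o, 'm) prederiv =
  DCat :: "'u scat \<Rightarrow> ('o, 'm) cat"
  DFun :: "'u sfunct \<Rightarrow> ('o, 'm, 'o, 'm) funct"
  DNat :: "'u sntrans \<Rightarrow> ('o, 'm, 'o, 'm) ntrans"

definition prederivator :: "('u :: universe, 'o, 'm) prederiv \<Rightarrow> bool" where
  "prederivator D \<longleftrightarrow>
    (\<forall>A. small_category A \<longrightarrow> category (DCat D A)) \<and>
    (\<forall>u. small_funct u \<longrightarrow> functor_from_to (DFun D u) (DCat D (Tgt u)) (DCat D (Src u))) \<and>
    (\<forall>\<alpha>. small_ntrans \<alpha> \<longrightarrow> ntrans_from_to (DNat D \<alpha>) (DFun D (NSrc \<alpha>)) (DFun D (NTgt \<alpha>))) \<and>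
    (\<forall>A. small_category A \<longrightarrow> DFun D (id_funct A) = id_funct (DCat D A)) \<and>
    (\<forall>u v. small_funct u \<and> small_funct v \<and> Tgt u = Src v \<longrightarrow>
      DFun D (v \<circ>\<^sub>F u) = DFun D u \<circ>\<^sub>F DFun D v) \<and>
    (\<forall>u. small_funct u \<longrightarrow> DNat D (id_ntrans u) = id_ntrans (DFun D u)) \<and>
    (\<forall>\<alpha> \<beta>. small_ntrans \<alpha> \<and> small_ntrans \<beta> \<and> NTgt \<alpha> = NSrc \<beta> \<longrightarrow>
      DNat D (vcomp \<beta> \<alpha>) = vcomp (DNat D \<beta>) (DNat D \<alpha>)) \<and>
    (\<forall>\<alpha> \<beta>. small_ntrans \<alpha> \<and> small_ntrans \<beta> \<and> Tgt (NSrc \<alpha>) = Src (NSrc \<beta>) \<longrightarrow>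
      DNat D (hcomp \<beta> \<alpha>) = hcomp (DNat D \<alpha>) (DNat D \<beta>))"

definition dia :: "('u :: universe, 'o, 'm) prederiv \<Rightarrow> 'u scat \<Rightarrow> 'o \<Rightarrow> ('u, 'u, 'o, 'm) funct" where
  "dia D A X =
    \<lparr>Src = A, Tgt = DCat D terminal_cat,
     OMap = (\<lambda>a\<in>Obj A. OMap (DFun D (pt A a)) X),
     AMap = (\<lambda>g\<in>Arr A. Cmp (DNat D (pt_arr A g)) X)\<rparr>"

section \<open>Derivators\<close>

definition lan :: "('u :: universe, 'o, 'm) prederiv \<Rightarrow> 'u sfunct \<Rightarrow> ('o, 'm, 'o, 'm) funct" where
  "lan D u = fst (left_adjoint (DFun D u))"

definition lan_unit :: "('u :: universe, 'o, 'm) prederiv \<Rightarrow> 'u sfunct \<Rightarrow> ('o, 'm, 'o, 'm) ntrans" where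
  "lan_unit D u = fst (snd (left_adjoint (DFun D u)))"

definition lan_counit :: "('u :: universe, 'o, 'm) prederiv \<Rightarrow> 'u sfunct \<Rightarrow> ('o, 'm, 'o, 'm) ntrans" where
  "lan_counit D u = snd (snd (left_adjoint (DFun D u)))"

definition ran :: "('u :: universe, 'o, 'm) prederiv \<Rightarrow> 'u sfunct \<Rightarrow> ('o, 'm, 'o, 'm) funct" where
  "ran D u = fst (right_adjoint (DFun D u))"

definition ran_unit :: "('u :: universe, 'o, 'm) prederiv \<Rightarrow> 'u sfunct \<Rightarrow> ('o, 'm, 'o, 'm) ntrans" where
  "ran_unit D u = fst (snd (right_adjoint (DFun D u)))"

definition ran_counit :: "('u :: universe, 'o, 'm) prederiv \<Rightarrow> 'u sfunct \<Rightarrow> ('o, 'm, 'o, 'm) ntrans" where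
  "ran_counit D u = snd (snd (right_adjoint (DFun D u)))"

abbreviation dcolim :: "('u :: universe, 'o, 'm) prederiv \<Rightarrow> 'u scat \<Rightarrow> ('o, 'm, 'o, 'm) funct" where
  "dcolim D A \<equiv> lan D (bang A)"

abbreviation dlim :: "('u :: universe, 'o, 'm) prederiv \<Rightarrow> 'u scat \<Rightarrow> ('o, 'm, 'o, 'm) funct" where
  "dlim D A \<equiv> ran D (bang A)"

text \<open>
  With \<open>J = (u/b)\<close> and \<open>p\<close> the projection, \<open>mate_colim D u b\<close> is the composite
  \<open>colim\<^sub>J p\<^sup>* \<Rightarrow> colim\<^sub>J p\<^sup>* u\<^sup>* u\<^sub>! \<Rightarrow> colim\<^sub>J \<pi>\<^sup>* b\<^sup>* u\<^sub>! \<Rightarrow> b\<^sup>* u\<^sub>!\<close>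
  of the unit of \<open>u\<^sub>! \<stileturn> u\<^sup>*\<close>, the image of \<open>slice_cell u b\<close>, and the counit of \<open>colim\<^sub>J \<stileturn> \<pi>\<^sup>*\<close>.
  Dually \<open>mate_lim D u b\<close>, with \<open>J = (b/u)\<close> and \<open>q\<close> the projection, is
  \<open>b\<^sup>* u\<^sub>* \<Rightarrow> lim\<^sub>J \<pi>\<^sup>* b\<^sup>* u\<^sub>* \<Rightarrow> lim\<^sub>J q\<^sup>* u\<^sup>* u\<^sub>* \<Rightarrow> lim\<^sub>J q\<^sup>*\<close>.
\<close>

definition mate_colim ::
    "('u :: universe, 'o, 'm) prederiv \<Rightarrow> 'u sfunct \<Rightarrow> 'u \<Rightarrow> ('o, 'm, 'o, 'm) ntrans" where
  "mate_colim D u b =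
    vcomp (rwhisk (lan_counit D (bang (slice u b))) (DFun D (pt (Tgt u) b) \<circ>\<^sub>F lan D u))
      (vcomp (rwhisk (lwhisk (dcolim D (slice u b)) (DNat D (slice_cell u b))) (lan D u))
        (lwhisk (dcolim D (slice u b) \<circ>\<^sub>F DFun D (slice_proj u b)) (lan_unit D u)))"

definition mate_lim ::
    "('u :: universe, 'o, 'm) prederiv \<Rightarrow> 'u sfunct \<Rightarrow> 'u \<Rightarrow> ('o, 'm, 'o, 'm) ntrans" where
  "mate_lim D u b =
    vcomp (lwhisk (dlim D (coslice u b) \<circ>\<^sub>F DFun D (coslice_proj u b)) (ran_counit D u))
      (vcomp (rwhisk (lwhisk (dlim D (coslice u b)) (DNat D (coslice_cell u b))) (ran D u))
        (rwhisk (ran_unit D (bang (coslice u b))) (DFun D (pt (Tgt u) b) \<circ>\<^sub>F ran D u)))"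

text \<open>
  As usual for 2-categories, a coproduct is sent to a product when the canonical comparison functor
  is an equivalence of categories.
\<close>

definition Der1 :: "('u :: universe, 'o, 'm) prederiv \<Rightarrow> bool" where
  "Der1 D \<longleftrightarrow> (\<forall>I A. small I \<and> (\<forall>i\<in>I. small_category (A i)) \<longrightarrow>
    is_equivalence (tuple_funct (DCat D (sum_cat I A)) I (\<lambda>i. DFun D (sum_incl I A i))))"

definition Der2 :: "('u :: universe, 'o, 'm) prederiv \<Rightarrow> bool" where
  "Der2 D \<longleftrightarrow> (\<forall>A. small_category A \<longrightarrow> (\<forall>f\<in>Arr (DCat D A).
    iso_arr (DCat D A) f \<longleftrightarrow>
    (\<forall>a\<in>Obj A. iso_arr (DCat D terminal_cat) (AMap (DFun D (pt A a)) f))))"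

definition Der3 :: "('u :: universe, 'o, 'm) prederiv \<Rightarrow> bool" where
  "Der3 D \<longleftrightarrow> (\<forall>u. small_funct u \<longrightarrow>
    has_left_adjoint (DFun D u) \<and> has_right_adjoint (DFun D u))"

definition Der4 :: "('u :: universe, 'o, 'm) prederiv \<Rightarrow> bool" where
  "Der4 D \<longleftrightarrow> (\<forall>u. small_funct u \<longrightarrow> (\<forall>b\<in>Obj (Tgt u).
    is_niso (mate_colim D u b) \<and> is_niso (mate_lim D u b)))"

definition derivator :: "('u :: universe, 'o, 'm) prederiv \<Rightarrow> bool" where
  "derivator D \<longleftrightarrow> prederivator D \<and> Der1 D \<and> Der2 D \<and> Der3 D \<and> Der4 D"

definition colimiting_cocone ::
    "('u :: universe, 'o, 'm) prederiv \<Rightarrow> 'u scat \<Rightarrow> 'o \<Rightarrow> bool" where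
  "colimiting_cocone D A X \<longleftrightarrow> X \<in> Obj (DCat D (rcone A)) \<and>
    (\<exists>Y\<in>Obj (DCat D A). isomorphic (DCat D (rcone A)) (OMap (lan D (rcone_incl A)) Y) X)"

end

theory Submission
  imports Defs
begin

text \<open>
  Write \<open>R\<close> for the cocone of \<open>S\<close>, \<open>i : S \<rightarrow> R\<close> for the inclusion, \<open>P : R \<rightarrow> 1\<close> for the projection, and
  \<open>X\<^sub>s\<close>, \<open>X\<^sub>\<infinity>\<close> for the values of \<open>X\<close>.

  Two facts turn the universal property of a coproduct into a statement about
  restriction along \<open>i\<close>. Since \<open>\<infinity>\<close> is terminal in \<open>R\<close>, the functor \<open>P\<close> is left adjoint to \<open>\<infinity> : 1 \<rightarrow> R\<close>, and
  \<open>D\<close> sends this adjunction to \<open>\<infinity>\<^sup>* \<stileturn> P\<^sup>*\<close>; an arrow \<open>h : X\<^sub>\<infinity> \<rightarrow> y\<close> thus amounts to an arrow \<open>X \<rightarrow> P\<^sup>* y\<close>,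
  whose value at \<open>s\<close> is \<open>h\<close> composed with the leg \<open>X\<^sub>s \<rightarrow> X\<^sub>\<infinity>\<close> (\<open>evaluation_at_terminal_adjunction\<close>).
  By Der1 a family of arrows \<open>X\<^sub>s \<rightarrow> y\<close> is the same as one arrow \<open>i\<^sup>* X \<rightarrow> i\<^sup>* P\<^sup>* y\<close>
  (\<open>discrete_arrows_pointwise\<close>). So the diagram of \<open>X\<close> is a coproduct cocone as soon as \<open>i\<^sup>*\<close> is bijective
  on arrows out of \<open>X\<close> (\<open>coproduct_of_restriction_bijective\<close>).

  If \<open>X\<close> is isomorphic to some \<open>i\<^sub>! Y\<close>, this bijectivity is the universal property of the unit
  \<open>Y \<rightarrow> i\<^sup>* i\<^sub>! Y\<close>, once the unit is known to be invertible
  (\<open>colimiting_cocone_restriction_bijective\<close>). Invertibility is where Der4 enters: the slice of \<open>i\<close>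
  over \<open>s\<close> is a point because \<open>S\<close> is discrete, so the base change mate at \<open>s\<close> is the unit at \<open>s\<close> up
  to isomorphism, and Der2 collects the points (\<open>lan_unit_iso_discrete\<close>).

  Conversely let the diagram of \<open>X\<close> be a coproduct cocone. The counit \<open>i\<^sub>! i\<^sup>* X \<rightarrow> X\<close> is invertible at
  every \<open>s\<close> by the triangle identity. By the first half its source is a coproduct cocone too, so at
  \<open>\<infinity>\<close> it is the comparison of two coproducts with isomorphic summands, hence invertible
  (\<open>coproduct_comparison_iso\<close>). By Der2 the counit is an isomorphism.
\<close>

section \<open>Arrows, functors and isomorphisms\<close>

lemma HomD: "f \<in> Hom C x y \<Longrightarrow> f \<in> Arr C \<and> Dom C f = x \<and> Cod C f = y"
  by (simp add: Hom_def)

lemma Hom_objs: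
  assumes "category C" "f \<in> Hom C x y"
  shows "x \<in> Obj C" "y \<in> Obj C"
  using assms unfolding category_def Hom_def by auto

lemma Id_Hom: "category C \<Longrightarrow> x \<in> Obj C \<Longrightarrow> Id C x \<in> Hom C x x"
  unfolding category_def by blast

lemma Comp_Hom:
  assumes "category C" "f \<in> Hom C x y" "g \<in> Hom C y z"
  shows "Comp C g f \<in> Hom C x z"
proof -
  have "composable C g f" "Dom C f = x" "Cod C g = z"
    using assms by (auto simp: composable_def Hom_def)
  then show ?thesis using assms(1) unfolding category_def by blast
qed

lemma Comp_Id_right:
  assumes "category C" "f \<in> Hom C x y"
  shows "Comp C f (Id C x) = f"
  using assms unfolding category_def Hom_def by auto

lemma Comp_Id_left:
  assumes "category C" "f \<in> Hom C x y"
  shows "Comp C (Id C y) f = f"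
  using assms unfolding category_def Hom_def by auto

lemma Comp_assoc:
  assumes "category C" "f \<in> Hom C w x" "g \<in> Hom C x y" "h \<in> Hom C y z"
  shows "Comp C (Comp C h g) f = Comp C h (Comp C g f)"
proof -
  have "composable C g f" "composable C h g"
    using assms by (auto simp: composable_def Hom_def)
  then show ?thesis using assms(1) unfolding category_def by blast
qed

lemma functor_cats:
  assumes "functor_from_to F C D"
  shows "category C" "category D"
  using assms unfolding functor_from_to_def is_functor_def by auto

lemma functor_obj: "functor_from_to F C D \<Longrightarrow> x \<in> Obj C \<Longrightarrow> OMap F x \<in> Obj D"
  unfolding functor_from_to_def is_functor_def by auto

lemma functor_Hom:
  assumes "functor_from_to F C D" "f \<in> Hom C x y"
  shows "AMap F f \<in> Hom D (OMap F x) (OMap F y)"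
  using assms unfolding functor_from_to_def is_functor_def Hom_def by auto

lemma functor_Comp:
  assumes "functor_from_to F C D" "f \<in> Hom C x y" "g \<in> Hom C y z"
  shows "AMap F (Comp C g f) = Comp D (AMap F g) (AMap F f)"
proof -
  have "composable C g f" using assms by (auto simp: composable_def Hom_def)
  then show ?thesis
    using assms(1) unfolding functor_from_to_def is_functor_def by blast
qed

lemma functor_Id: "functor_from_to F C D \<Longrightarrow> x \<in> Obj C \<Longrightarrow> AMap F (Id C x) = Id D (OMap F x)"
  unfolding functor_from_to_def is_functor_def by auto

lemma comp_functor:
  assumes F: "functor_from_to F A B" and G: "functor_from_to G B C"
  shows "functor_from_to (G \<circ>\<^sub>F F) A C"
proof -
  have F': "is_functor F" "Src F = A" "Tgt F = B" and G': "is_functor G" "Src G = B" "Tgt G = C"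
    using assms by (auto simp: functor_from_to_def)
  have cat: "category A" "category C" using functor_cats[OF F] functor_cats[OF G] by auto
  have H: "AMap G (AMap F f) \<in> Hom C (OMap G (OMap F (Dom A f))) (OMap G (OMap F (Cod A f)))"
    if "f \<in> Arr A" for f
    using functor_Hom[OF G functor_Hom[OF F, of f "Dom A f" "Cod A f"]] that by (simp add: Hom_def)
  have 1: "Dom A f \<in> Obj A" "Cod A f \<in> Obj A" if "f \<in> Arr A" for f
    using cat(1) that unfolding category_def by auto
  have 2: "Comp A g f \<in> Arr A" "AMap G (AMap F (Comp A g f)) =
      Comp C (AMap G (AMap F g)) (AMap G (AMap F f))" if "composable A g f" for g f
  proof -
    have f: "f \<in> Hom A (Dom A f) (Cod A f)" and g: "g \<in> Hom A (Cod A f) (Cod A g)"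
      using that by (auto simp: composable_def Hom_def)
    show "Comp A g f \<in> Arr A" using Comp_Hom[OF cat(1) f g] by (simp add: Hom_def)
    show "AMap G (AMap F (Comp A g f)) = Comp C (AMap G (AMap F g)) (AMap G (AMap F f))"
      using functor_Comp[OF F f g] functor_Comp[OF G functor_Hom[OF F f] functor_Hom[OF F g]]
      by simp
  qed
  have 3: "Id A x \<in> Arr A" "AMap G (AMap F (Id A x)) = Id C (OMap G (OMap F x))"
      "OMap G (OMap F x) \<in> Obj C" if "x \<in> Obj A" for x
    using Id_Hom[OF cat(1) that] functor_Id[OF F that] functor_Id[OF G functor_obj[OF F that]]
      functor_obj[OF G functor_obj[OF F that]]
    by (auto simp: Hom_def)
  show ?thesis
    unfolding functor_from_to_def is_functor_def comp_funct_def
    using cat H 1 2 3 by (auto simp: F' G' Hom_def composable_def)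
qed

lemma id_functor: "category C \<Longrightarrow> functor_from_to (id_funct C) C C"
  unfolding functor_from_to_def is_functor_def id_funct_def
  by (auto simp: category_def composable_def Hom_def)

lemma ntrans_Hom:
  assumes "ntrans_from_to \<alpha> F G" "functor_from_to F C D" "x \<in> Obj C"
  shows "Cmp \<alpha> x \<in> Hom D (OMap F x) (OMap G x)"
  using assms unfolding ntrans_from_to_def is_ntrans_def functor_from_to_def by auto

lemma ntrans_natural:
  assumes "ntrans_from_to \<alpha> F G" "functor_from_to F C D" "f \<in> Hom C x y"
  shows "Comp D (AMap G f) (Cmp \<alpha> x) = Comp D (Cmp \<alpha> y) (AMap F f)"
  using assms unfolding ntrans_from_to_def is_ntrans_def functor_from_to_def Hom_def by auto

lemma ntrans_eqI:
  fixes \<alpha> \<beta> :: "('o, 'a, 'p, 'b) ntrans"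
  assumes "NSrc \<alpha> = NSrc \<beta>" "NTgt \<alpha> = NTgt \<beta>"
    and "Cmp \<alpha> \<in> extensional A" "Cmp \<beta> \<in> extensional A"
    and "\<And>x. x \<in> A \<Longrightarrow> Cmp \<alpha> x = Cmp \<beta> x"
  shows "\<alpha> = \<beta>"
proof -
  have "Cmp \<alpha> = Cmp \<beta>" using assms by (intro extensionalityI[where A = A]) auto
  then show ?thesis using assms by (cases \<alpha>; cases \<beta>) simp
qed

lemma iso_arrI:
  assumes "f \<in> Hom C x y" "g \<in> Hom C y x" "Comp C g f = Id C x" "Comp C f g = Id C y"
  shows "iso_arr C f"
  using assms unfolding iso_arr_def Hom_def by auto

lemma iso_arr_inverse:
  assumes "f \<in> Hom C x y" "iso_arr C f"
  shows "\<exists>g. g \<in> Hom C y x \<and> Comp C g f = Id C x \<and> Comp C f g = Id C y"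
  using assms unfolding iso_arr_def Hom_def by auto

lemma functor_iso:
  assumes F: "functor_from_to F C D" and f: "f \<in> Hom C x y" "iso_arr C f"
  shows "iso_arr D (AMap F f)"
proof -
  obtain g where g: "g \<in> Hom C y x" "Comp C g f = Id C x" "Comp C f g = Id C y"
    using iso_arr_inverse[OF f] by blast
  have "x \<in> Obj C" "y \<in> Obj C" using Hom_objs[OF functor_cats(1)[OF F] f(1)] by auto
  then show ?thesis
    using functor_Comp[OF F f(1) g(1)] functor_Comp[OF F g(1) f(1)] functor_Id[OF F] g
      functor_Hom[OF F f(1)] functor_Hom[OF F g(1)]
    by (metis iso_arrI)
qed

lemma iso_Comp:
  assumes C: "category C" and f: "f \<in> Hom C x y" "iso_arr C f" and g: "g \<in> Hom C y z" "iso_arr C g"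
  shows "iso_arr C (Comp C g f)"
proof -
  obtain f' where f': "f' \<in> Hom C y x" "Comp C f' f = Id C x" "Comp C f f' = Id C y"
    using iso_arr_inverse[OF f] by blast
  obtain g' where g': "g' \<in> Hom C z y" "Comp C g' g = Id C y" "Comp C g g' = Id C z"
    using iso_arr_inverse[OF g] by blast
  have "Comp C (Comp C f' g') (Comp C g f) = Comp C f' (Comp C (Comp C g' g) f)"
    using Comp_assoc[OF C Comp_Hom[OF C f(1) g(1)] g'(1) f'(1)] Comp_assoc[OF C f(1) g(1) g'(1)]
    by simp
  then have 1: "Comp C (Comp C f' g') (Comp C g f) = Id C x"
    using f' g' Comp_Id_left[OF C f(1)] by simp
  have "Comp C (Comp C g f) (Comp C f' g') = Comp C g (Comp C (Comp C f f') g')"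
    using Comp_assoc[OF C Comp_Hom[OF C g'(1) f'(1)] f(1) g(1)] Comp_assoc[OF C g'(1) f'(1) f(1)]
    by simp
  then have 2: "Comp C (Comp C g f) (Comp C f' g') = Id C z"
    using f' g' Comp_Id_left[OF C g'(1)] by simp
  show ?thesis
    using iso_arrI[OF Comp_Hom[OF C f(1) g(1)] Comp_Hom[OF C g'(1) f'(1)] 1 2] .
qed

text \<open>
  A left inverse of an isomorphism is its inverse. With a triangle identity this passes
  invertibility from a unit to a counit.
\<close>

lemma retraction_of_iso:
  assumes C: "category C" and e: "e \<in> Hom C x y" "iso_arr C e"
    and r: "r \<in> Hom C y x" "Comp C r e = Id C x"
  shows "iso_arr C r"
proof -
  obtain g where g: "g \<in> Hom C y x" "Comp C g e = Id C x" "Comp C e g = Id C y"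
    using iso_arr_inverse[OF e] by blast
  have "r = Comp C (Comp C r e) g"
    using Comp_assoc[OF C g(1) e(1) r(1)] g(3) Comp_Id_right[OF C r(1)] by simp
  also have "\<dots> = g" using r(2) Comp_Id_left[OF C g(1)] by simp
  finally show ?thesis using iso_arrI[OF r(1) e(1)] r(2) g by simp
qed

lemma iso_epi:
  assumes C: "category C" and e: "e \<in> Hom C x y" "iso_arr C e"
    and "f \<in> Hom C y z" "g \<in> Hom C y z" "Comp C f e = Comp C g e"
  shows "f = g"
proof -
  obtain e' where e': "e' \<in> Hom C y x" "Comp C e e' = Id C y"
    using iso_arr_inverse[OF e] by blast
  show ?thesis
    using Comp_assoc[OF C e'(1) e(1)] assms(4-6) e'(2) Comp_Id_right[OF C] by metis
qed

lemma iso_mono: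
  assumes C: "category C" and e: "e \<in> Hom C y z" "iso_arr C e"
    and "f \<in> Hom C x y" "g \<in> Hom C x y" "Comp C e f = Comp C e g"
  shows "f = g"
proof -
  obtain e' where e': "e' \<in> Hom C z y" "Comp C e' e = Id C y"
    using iso_arr_inverse[OF e] by blast
  show ?thesis
    using Comp_assoc[OF C _ e(1) e'(1)] assms(4-6) e'(2) Comp_Id_left[OF C] by metis
qed

lemma coproduct_factor:
  assumes cop: "is_coproduct C I x c \<iota>" and "y \<in> Obj C" "\<And>i. i \<in> I \<Longrightarrow> f i \<in> Hom C (x i) y"
  shows "\<exists>h. h \<in> Hom C c y \<and> (\<forall>i\<in>I. Comp C h (\<iota> i) = f i)"
proof -
  have "\<forall>f. (\<forall>i\<in>I. f i \<in> Hom C (x i) y) \<longrightarrow>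
      (\<exists>!h. h \<in> Hom C c y \<and> (\<forall>i\<in>I. Comp C h (\<iota> i) = f i))"
    using cop \<open>y \<in> Obj C\<close> unfolding is_coproduct_def by blast
  then have "\<exists>!h. h \<in> Hom C c y \<and> (\<forall>i\<in>I. Comp C h (\<iota> i) = f i)"
    using assms(3) by blast
  then show ?thesis by blast
qed

lemma coproduct_jointly_epi:
  assumes C: "category C" and cop: "is_coproduct C I x c \<iota>"
    and m: "m \<in> Hom C c y" "m' \<in> Hom C c y"
    and eq: "\<And>i. i \<in> I \<Longrightarrow> Comp C m (\<iota> i) = Comp C m' (\<iota> i)"
  shows "m = m'"
proof -
  have "y \<in> Obj C" using Hom_objs[OF C m(1)] by blast
  then have U: "\<forall>f. (\<forall>i\<in>I. f i \<in> Hom C (x i) y) \<longrightarrow>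
      (\<exists>!h. h \<in> Hom C c y \<and> (\<forall>i\<in>I. Comp C h (\<iota> i) = f i))"
    using cop unfolding is_coproduct_def by blast
  have "\<forall>i\<in>I. Comp C m' (\<iota> i) \<in> Hom C (x i) y"
    using cop Comp_Hom[OF C _ m(2)] unfolding is_coproduct_def by blast
  then have "\<exists>!h. h \<in> Hom C c y \<and> (\<forall>i\<in>I. Comp C h (\<iota> i) = Comp C m' (\<iota> i))"
    using U[rule_format, of "\<lambda>i. Comp C m' (\<iota> i)"] by blast
  then show ?thesis using m eq by blast
qed

text \<open>
  The inverse is induced by the inverses of the \<open>g i\<close>; both composites fix the coproduct
  inclusions.
\<close>

lemma coproduct_comparison_iso:
  assumes C: "category C"
    and cop: "is_coproduct C I x c \<iota>" and cop': "is_coproduct C I x' c' \<iota>'"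
    and f: "f \<in> Hom C c c'"
    and g: "\<And>i. i \<in> I \<Longrightarrow> g i \<in> Hom C (x i) (x' i)" "\<And>i. i \<in> I \<Longrightarrow> iso_arr C (g i)"
    and comm: "\<And>i. i \<in> I \<Longrightarrow> Comp C f (\<iota> i) = Comp C (\<iota>' i) (g i)"
  shows "iso_arr C f"
proof -
  have "\<exists>k. \<forall>i\<in>I. k i \<in> Hom C (x' i) (x i) \<and> Comp C (k i) (g i) = Id C (x i) \<and>
      Comp C (g i) (k i) = Id C (x' i)"
    using iso_arr_inverse[OF g] by (intro bchoice ballI) blast
  then obtain k where k: "\<And>i. i \<in> I \<Longrightarrow> k i \<in> Hom C (x' i) (x i)"
      "\<And>i. i \<in> I \<Longrightarrow> Comp C (k i) (g i) = Id C (x i)"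
      "\<And>i. i \<in> I \<Longrightarrow> Comp C (g i) (k i) = Id C (x' i)" by blast
  have \<iota>: "\<And>i. i \<in> I \<Longrightarrow> \<iota> i \<in> Hom C (x i) c" and \<iota>': "\<And>i. i \<in> I \<Longrightarrow> \<iota>' i \<in> Hom C (x' i) c'"
    and c: "c \<in> Obj C" "c' \<in> Obj C"
    using cop cop' unfolding is_coproduct_def by auto
  have "Comp C (\<iota> i) (k i) \<in> Hom C (x' i) c" if "i \<in> I" for i
    using Comp_Hom[OF C k(1) \<iota>] that by blast
  then obtain h where h: "h \<in> Hom C c' c" "\<And>i. i \<in> I \<Longrightarrow> Comp C h (\<iota>' i) = Comp C (\<iota> i) (k i)"
    using coproduct_factor[OF cop' c(1), of "\<lambda>i. Comp C (\<iota> i) (k i)"] by blast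
  have "Comp C h f = Id C c"
  proof (rule coproduct_jointly_epi[OF C cop Comp_Hom[OF C f h(1)] Id_Hom[OF C c(1)]])
    fix i assume i: "i \<in> I"
    have "Comp C (Comp C h f) (\<iota> i) = Comp C (Comp C h (\<iota>' i)) (g i)"
      using Comp_assoc[OF C \<iota>[OF i] f h(1)] Comp_assoc[OF C g(1)[OF i] \<iota>'[OF i] h(1)] comm[OF i]
      by simp
    also have "\<dots> = Comp C (\<iota> i) (Comp C (k i) (g i))"
      using h(2)[OF i] Comp_assoc[OF C g(1)[OF i] k(1)[OF i] \<iota>[OF i]] by simp
    finally show "Comp C (Comp C h f) (\<iota> i) = Comp C (Id C c) (\<iota> i)"
      using k(2)[OF i] Comp_Id_right[OF C \<iota>[OF i]] Comp_Id_left[OF C \<iota>[OF i]] by simp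
  qed
  moreover have "Comp C f h = Id C c'"
  proof (rule coproduct_jointly_epi[OF C cop' Comp_Hom[OF C h(1) f] Id_Hom[OF C c(2)]])
    fix i assume i: "i \<in> I"
    have "Comp C (Comp C f h) (\<iota>' i) = Comp C (Comp C f (\<iota> i)) (k i)"
      using Comp_assoc[OF C \<iota>'[OF i] h(1) f] Comp_assoc[OF C k(1)[OF i] \<iota>[OF i] f] h(2)[OF i]
      by simp
    also have "\<dots> = Comp C (\<iota>' i) (Comp C (g i) (k i))"
      using comm[OF i] Comp_assoc[OF C k(1)[OF i] g(1)[OF i] \<iota>'[OF i]] by simp
    finally show "Comp C (Comp C f h) (\<iota>' i) = Comp C (Id C c') (\<iota>' i)"
      using k(3)[OF i] Comp_Id_right[OF C \<iota>'[OF i]] Comp_Id_left[OF C \<iota>'[OF i]] by simp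
  qed
  ultimately show ?thesis using iso_arrI[OF f h(1)] by blast
qed

section \<open>Equivalences and adjunctions\<close>

text \<open>
  Naturality writes \<open>f\<close>, up to the isomorphisms \<open>\<alpha>\<close>, as \<open>G (F f)\<close>, which only depends on \<open>F f\<close>.
\<close>

lemma faithful_of_left_inverse:
  assumes F: "functor_from_to F C D" and G: "functor_from_to G D C"
    and \<alpha>: "ntrans_from_to \<alpha> (id_funct C) (G \<circ>\<^sub>F F)" "is_niso \<alpha>"
    and f: "f \<in> Hom C x y" "g \<in> Hom C x y" "AMap F f = AMap F g"
  shows "f = g"
proof -
  note C = functor_cats(1)[OF F]
  note I = id_functor[OF C]
  have xy: "x \<in> Obj C" "y \<in> Obj C" using Hom_objs[OF C f(1)] by auto
  have a: "Cmp \<alpha> z \<in> Hom C z (OMap (G \<circ>\<^sub>F F) z)" if "z \<in> Obj C" for z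
    using ntrans_Hom[OF \<alpha>(1) I that] that by (simp add: id_funct_def)
  have iso: "iso_arr C (Cmp \<alpha> z)" if "z \<in> Obj C" for z
    using \<alpha> that unfolding is_niso_def ntrans_from_to_def by (auto simp: id_funct_def)
  have ar: "f \<in> Arr C" "g \<in> Arr C" using f by (auto simp: Hom_def)
  have "Comp C (AMap (G \<circ>\<^sub>F F) f) (Cmp \<alpha> x) = Comp C (Cmp \<alpha> y) f"
    using ntrans_natural[OF \<alpha>(1) I f(1)] ar by (simp add: id_funct_def)
  moreover have "Comp C (AMap (G \<circ>\<^sub>F F) g) (Cmp \<alpha> x) = Comp C (Cmp \<alpha> y) g"
    using ntrans_natural[OF \<alpha>(1) I f(2)] ar by (simp add: id_funct_def)
  moreover have "AMap (G \<circ>\<^sub>F F) f = AMap (G \<circ>\<^sub>F F) g"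
    using F ar f(3) by (simp add: comp_funct_def functor_from_to_def)
  ultimately have "Comp C (Cmp \<alpha> y) f = Comp C (Cmp \<alpha> y) g" by simp
  then show ?thesis using iso_mono[OF C a[OF xy(2)] iso[OF xy(2)] f(1,2)] by blast
qed

lemma inverse_niso:
  assumes \<beta>: "ntrans_from_to \<beta> F G" "is_niso \<beta>"
    and F: "functor_from_to F C D" and G: "functor_from_to G C D"
  shows "\<exists>\<gamma>. ntrans_from_to \<gamma> G F \<and> is_niso \<gamma>"
proof -
  note D = functor_cats(2)[OF F]
  have hom: "Cmp \<beta> x \<in> Hom D (OMap F x) (OMap G x)" if "x \<in> Obj C" for x
    using ntrans_Hom[OF \<beta>(1) F that] .
  have iso: "iso_arr D (Cmp \<beta> x)" if "x \<in> Obj C" for x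
    using \<beta> F that unfolding is_niso_def ntrans_from_to_def functor_from_to_def by auto
  have "\<exists>k. \<forall>x\<in>Obj C. k x \<in> Hom D (OMap G x) (OMap F x) \<and>
      Comp D (k x) (Cmp \<beta> x) = Id D (OMap F x) \<and> Comp D (Cmp \<beta> x) (k x) = Id D (OMap G x)"
    using iso_arr_inverse[OF hom iso] by (intro bchoice ballI) blast
  then obtain k where k: "\<And>x. x \<in> Obj C \<Longrightarrow> k x \<in> Hom D (OMap G x) (OMap F x)"
      "\<And>x. x \<in> Obj C \<Longrightarrow> Comp D (k x) (Cmp \<beta> x) = Id D (OMap F x)"
      "\<And>x. x \<in> Obj C \<Longrightarrow> Comp D (Cmp \<beta> x) (k x) = Id D (OMap G x)" by blast
  define \<gamma> where "\<gamma> = \<lparr>NSrc = G, NTgt = F, Cmp = restrict k (Obj C)\<rparr>"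
  have nat: "Comp D (AMap F f) (k x) = Comp D (k y) (AMap G f)" if f: "f \<in> Hom C x y" for f x y
  proof -
    have xy: "x \<in> Obj C" "y \<in> Obj C" using Hom_objs[OF functor_cats(1)[OF F] f] by auto
    note Ff = functor_Hom[OF F f] and Gf = functor_Hom[OF G f]
    show ?thesis
    proof (rule iso_mono[OF D hom[OF xy(2)] iso[OF xy(2)]])
      show "Comp D (AMap F f) (k x) \<in> Hom D (OMap G x) (OMap F y)"
        "Comp D (k y) (AMap G f) \<in> Hom D (OMap G x) (OMap F y)"
        using Comp_Hom[OF D k(1)[OF xy(1)] Ff] Comp_Hom[OF D Gf k(1)[OF xy(2)]] by auto
      have "Comp D (Cmp \<beta> y) (Comp D (AMap F f) (k x)) = Comp D (AMap G f) (Comp D (Cmp \<beta> x) (k x))"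
        using Comp_assoc[OF D k(1)[OF xy(1)] Ff hom[OF xy(2)]]
          Comp_assoc[OF D k(1)[OF xy(1)] hom[OF xy(1)] Gf] ntrans_natural[OF \<beta>(1) F f] by simp
      also have "\<dots> = Comp D (Comp D (Cmp \<beta> y) (k y)) (AMap G f)"
        using k(3) xy Comp_Id_left[OF D Gf] Comp_Id_right[OF D Gf] by simp
      also have "\<dots> = Comp D (Cmp \<beta> y) (Comp D (k y) (AMap G f))"
        using Comp_assoc[OF D Gf k(1)[OF xy(2)] hom[OF xy(2)]] .
      finally show "Comp D (Cmp \<beta> y) (Comp D (AMap F f) (k x)) =
        Comp D (Cmp \<beta> y) (Comp D (k y) (AMap G f))" .
    qed
  qed
  have C: "category C" using functor_cats(1)[OF F] .
  have ob: "Dom C f \<in> Obj C" "Cod C f \<in> Obj C" "f \<in> Hom C (Dom C f) (Cod C f)" if "f \<in> Arr C" for f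
    using C that unfolding category_def Hom_def by auto
  have FG: "is_functor F" "is_functor G" "Src F = C" "Src G = C" "Tgt F = D" "Tgt G = D"
    using F G by (auto simp: functor_from_to_def)
  have "ntrans_from_to \<gamma> G F"
    unfolding ntrans_from_to_def is_ntrans_def \<gamma>_def using FG k(1) nat ob by auto
  moreover have "iso_arr D (k x)" if "x \<in> Obj C" for x
    using iso_arrI[OF k(1)[OF that] hom[OF that]] k(2,3)[OF that] by simp
  then have "is_niso \<gamma>" using \<open>ntrans_from_to \<gamma> G F\<close> FG
    unfolding is_niso_def ntrans_from_to_def by (auto simp: \<gamma>_def)
  ultimately show ?thesis by blast
qed

text \<open>
  A preimage of \<open>g\<close> is obtained by conjugating \<open>G g\<close> with \<open>\<alpha>\<close>: it has the same image as \<open>g\<close> under \<open>F\<close>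
  followed by \<open>G\<close>, and \<open>G\<close> is faithful as well. The latter needs \<open>\<beta>\<close> in the direction of a unit,
  which \<open>inverse_niso\<close> provides.
\<close>

lemma equivalence_fully_faithful:
  assumes F: "functor_from_to F C D" and eq: "is_equivalence F"
    and x: "x \<in> Obj C" and y: "y \<in> Obj C" and g: "g \<in> Hom D (OMap F x) (OMap F y)"
  shows "\<exists>!f. f \<in> Hom C x y \<and> AMap F f = g"
proof -
  have FCD: "is_functor F" "Src F = C" "Tgt F = D" using F by (auto simp: functor_from_to_def)
  obtain G \<alpha> \<beta> where G: "functor_from_to G D C"
    and \<alpha>: "ntrans_from_to \<alpha> (id_funct C) (G \<circ>\<^sub>F F)" "is_niso \<alpha>"
    and \<beta>: "ntrans_from_to \<beta> (F \<circ>\<^sub>F G) (id_funct D)" "is_niso \<beta>"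
    using eq FCD unfolding is_equivalence_def by auto
  note C = functor_cats(1)[OF F] and D = functor_cats(2)[OF F]
  obtain \<gamma> where \<gamma>: "ntrans_from_to \<gamma> (id_funct D) (F \<circ>\<^sub>F G)" "is_niso \<gamma>"
    using inverse_niso[OF \<beta> comp_functor[OF G F] id_functor[OF D]] by blast
  note I = id_functor[OF C]
  have GF: "OMap (G \<circ>\<^sub>F F) z = OMap G (OMap F z)" if "z \<in> Obj C" for z
    using that FCD by (simp add: comp_funct_def)
  have a: "Cmp \<alpha> z \<in> Hom C z (OMap G (OMap F z))" if "z \<in> Obj C" for z
    using ntrans_Hom[OF \<alpha>(1) I that] that GF by (simp add: id_funct_def)
  have iso: "iso_arr C (Cmp \<alpha> z)" if "z \<in> Obj C" for z
    using \<alpha> that unfolding is_niso_def ntrans_from_to_def by (auto simp: id_funct_def)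
  obtain b where b: "b \<in> Hom C (OMap G (OMap F y)) y" "Comp C b (Cmp \<alpha> y) = Id C y"
      "Comp C (Cmp \<alpha> y) b = Id C (OMap G (OMap F y))"
    using iso_arr_inverse[OF a[OF y] iso[OF y]] by blast
  note Gg = functor_Hom[OF G g]
  define m where "m = Comp C (AMap G g) (Cmp \<alpha> x)"
  have m: "m \<in> Hom C x (OMap G (OMap F y))"
    unfolding m_def using Comp_Hom[OF C a[OF x] Gg] .
  define f where "f = Comp C b m"
  have f: "f \<in> Hom C x y" unfolding f_def using Comp_Hom[OF C m b(1)] .
  have "Comp C (Cmp \<alpha> y) f = Comp C (AMap G g) (Cmp \<alpha> x)"
    using Comp_assoc[OF C m b(1) a[OF y]] b(3) Comp_Id_left[OF C m] unfolding f_def m_def by simp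
  moreover have "Comp C (AMap (G \<circ>\<^sub>F F) f) (Cmp \<alpha> x) = Comp C (Cmp \<alpha> y) f"
    using ntrans_natural[OF \<alpha>(1) I f] f by (simp add: id_funct_def Hom_def)
  moreover have "AMap (G \<circ>\<^sub>F F) f = AMap G (AMap F f)"
    using f FCD by (simp add: comp_funct_def Hom_def)
  ultimately have e: "Comp C (AMap G (AMap F f)) (Cmp \<alpha> x) = Comp C (AMap G g) (Cmp \<alpha> x)"
    by simp
  have "AMap G (AMap F f) = AMap G g"
    using iso_epi[OF C a[OF x] iso[OF x] functor_Hom[OF G functor_Hom[OF F f]] Gg e] .
  then have "AMap F f = g"
    using faithful_of_left_inverse[OF G F \<gamma> functor_Hom[OF F f] g] by blast
  moreover have "f' = f''" if "f' \<in> Hom C x y" "f'' \<in> Hom C x y" "AMap F f' = AMap F f''" for f' f''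
    using faithful_of_left_inverse[OF F G \<alpha> that] .
  ultimately show ?thesis using f by metis
qed

text \<open>
  The units and counits of \<open>adjunction\<close> live on composite functors, whose values are only defined
  by restriction; these rules give the same data in terms of \<open>L\<close> and \<open>R\<close>.
\<close>

lemma adjunctionD:
  assumes adj: "adjunction L R \<eta> \<epsilon>" and L: "functor_from_to L C D"
  shows adj_right: "functor_from_to R D C"
    and adj_unit_Hom: "x \<in> Obj C \<Longrightarrow> Cmp \<eta> x \<in> Hom C x (OMap R (OMap L x))"
    and adj_counit_Hom: "y \<in> Obj D \<Longrightarrow> Cmp \<epsilon> y \<in> Hom D (OMap L (OMap R y)) y"
    and adj_unit_natural: "f \<in> Hom C x x' \<Longrightarrow>
      Comp C (AMap R (AMap L f)) (Cmp \<eta> x) = Comp C (Cmp \<eta> x') f"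
    and adj_counit_natural: "g \<in> Hom D y y' \<Longrightarrow>
      Comp D g (Cmp \<epsilon> y) = Comp D (Cmp \<epsilon> y') (AMap L (AMap R g))"
    and adj_triangle_L: "x \<in> Obj C \<Longrightarrow>
      Comp D (Cmp \<epsilon> (OMap L x)) (AMap L (Cmp \<eta> x)) = Id D (OMap L x)"
    and adj_triangle_R: "y \<in> Obj D \<Longrightarrow>
      Comp C (AMap R (Cmp \<epsilon> y)) (Cmp \<eta> (OMap R y)) = Id C (OMap R y)"
proof -
  have LD: "Src L = C" "Tgt L = D" using L by (auto simp: functor_from_to_def)
  show R: "functor_from_to R D C" using adj LD unfolding adjunction_def by auto
  have RD: "Src R = D" "Tgt R = C" using R by (auto simp: functor_from_to_def)
  have \<eta>: "ntrans_from_to \<eta> (id_funct C) (R \<circ>\<^sub>F L)" and \<epsilon>: "ntrans_from_to \<epsilon> (L \<circ>\<^sub>F R) (id_funct D)"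
    using adj LD unfolding adjunction_def by auto
  note I = id_functor[OF functor_cats(1)[OF L]] and LR = comp_functor[OF R L]
  show "x \<in> Obj C \<Longrightarrow> Cmp \<eta> x \<in> Hom C x (OMap R (OMap L x))"
    using ntrans_Hom[OF \<eta> I] by (force simp: id_funct_def comp_funct_def LD)
  show "y \<in> Obj D \<Longrightarrow> Cmp \<epsilon> y \<in> Hom D (OMap L (OMap R y)) y"
    using ntrans_Hom[OF \<epsilon> LR] by (force simp: id_funct_def comp_funct_def RD)
  show "f \<in> Hom C x x' \<Longrightarrow> Comp C (AMap R (AMap L f)) (Cmp \<eta> x) = Comp C (Cmp \<eta> x') f"
    using ntrans_natural[OF \<eta> I, of f x x'] HomD[of f C x x'] by (simp add: id_funct_def comp_funct_def LD)
  show "g \<in> Hom D y y' \<Longrightarrow> Comp D g (Cmp \<epsilon> y) = Comp D (Cmp \<epsilon> y') (AMap L (AMap R g))"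
    using ntrans_natural[OF \<epsilon> LR, of g y y'] HomD[of g D y y'] by (simp add: id_funct_def comp_funct_def RD)
  show "x \<in> Obj C \<Longrightarrow> Comp D (Cmp \<epsilon> (OMap L x)) (AMap L (Cmp \<eta> x)) = Id D (OMap L x)"
    "y \<in> Obj D \<Longrightarrow> Comp C (AMap R (Cmp \<epsilon> y)) (Cmp \<eta> (OMap R y)) = Id C (OMap R y)"
    using adj unfolding adjunction_def LD RD by auto
qed

lemma transpose_of_transpose:
  assumes adj: "adjunction L R \<eta> \<epsilon>" and L: "functor_from_to L C D"
    and x: "x \<in> Obj C" and y: "y \<in> Obj D" and g: "g \<in> Hom C x (OMap R y)"
  shows "Comp C (AMap R (Comp D (Cmp \<epsilon> y) (AMap L g))) (Cmp \<eta> x) = g"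
proof -
  note A = adjunctionD[OF adj L]
  note C = functor_cats(1)[OF L]
  note Lg = functor_Hom[OF L g]
  have "Comp C (AMap R (Comp D (Cmp \<epsilon> y) (AMap L g))) (Cmp \<eta> x) =
      Comp C (AMap R (Cmp \<epsilon> y)) (Comp C (AMap R (AMap L g)) (Cmp \<eta> x))"
    using functor_Comp[OF A(1) Lg A(3)[OF y]]
      Comp_assoc[OF C A(2)[OF x] functor_Hom[OF A(1) Lg] functor_Hom[OF A(1) A(3)[OF y]]] by simp
  also have "\<dots> = Comp C (Comp C (AMap R (Cmp \<epsilon> y)) (Cmp \<eta> (OMap R y))) g"
    using A(4)[OF g] Comp_assoc[OF C g A(2) functor_Hom[OF A(1) A(3)[OF y]]]
      functor_obj[OF A(1) y] by simp
  finally show ?thesis using A(7)[OF y] Comp_Id_left[OF C g] by simp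
qed

text \<open>
  The solution is the transpose of \<open>g\<close>. Any solution equals it by naturality of the counit and
  the triangle identity at \<open>L x\<close>.
\<close>

lemma unit_universal:
  assumes adj: "adjunction L R \<eta> \<epsilon>" and L: "functor_from_to L C D"
    and x: "x \<in> Obj C" and y: "y \<in> Obj D" and g: "g \<in> Hom C x (OMap R y)"
  shows "\<exists>!k. k \<in> Hom D (OMap L x) y \<and> Comp C (AMap R k) (Cmp \<eta> x) = g"
proof -
  note A = adjunctionD[OF adj L]
  note D = functor_cats(2)[OF L]
  have "k = Comp D (Cmp \<epsilon> y) (AMap L g)"
    if k: "k \<in> Hom D (OMap L x) y" and kg: "Comp C (AMap R k) (Cmp \<eta> x) = g" for k
  proof -
    note Rk = functor_Hom[OF A(1) k] and \<eta> = A(2)[OF x]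
    note Lx = functor_obj[OF L x]
    have "Comp D (Cmp \<epsilon> y) (AMap L g) =
        Comp D (Comp D (Cmp \<epsilon> y) (AMap L (AMap R k))) (AMap L (Cmp \<eta> x))"
      using functor_Comp[OF L \<eta> Rk] kg
        Comp_assoc[OF D functor_Hom[OF L \<eta>] functor_Hom[OF L Rk] A(3)[OF y]] by simp
    also have "\<dots> = Comp D k (Comp D (Cmp \<epsilon> (OMap L x)) (AMap L (Cmp \<eta> x)))"
      using A(5)[OF k] Comp_assoc[OF D functor_Hom[OF L \<eta>] A(3)[OF Lx] k] by simp
    finally show ?thesis using A(6)[OF x] Comp_Id_right[OF D k] by simp
  qed
  moreover have "Comp D (Cmp \<epsilon> y) (AMap L g) \<in> Hom D (OMap L x) y"
    using Comp_Hom[OF D functor_Hom[OF L g] A(3)[OF y]] .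
  ultimately show ?thesis using transpose_of_transpose[OF adj L x y g] by metis
qed

text \<open>
  The functor \<open>R\<close> is bijective, so \<open>\<eta>\<close> at \<open>x = R y\<close> is \<open>R g\<close> for a unique \<open>g\<close>. The two triangle identities
  say that \<open>g\<close> and \<open>\<epsilon>\<close> at \<open>y\<close> are inverse to each other.
\<close>

lemma unit_iso_of_right_adjoint_invertible:
  assumes adj: "adjunction L R \<eta> \<epsilon>" and L: "functor_from_to L C D"
    and R': "functor_from_to R' C D"
    and RR': "R \<circ>\<^sub>F R' = id_funct C" and R'R: "R' \<circ>\<^sub>F R = id_funct D"
    and x: "x \<in> Obj C"
  shows "iso_arr C (Cmp \<eta> x)"
proof -
  note A = adjunctionD[OF adj L]
  note R = A(1)
  note C = functor_cats(1)[OF L] and D = functor_cats(2)[OF L]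
  have S: "Src R = D" "Src R' = C" using R R' by (auto simp: functor_from_to_def)
  have o1: "OMap R (OMap R' z) = z" if "z \<in> Obj C" for z
    using arg_cong[OF RR', of "\<lambda>F. OMap F z"] that by (simp add: comp_funct_def id_funct_def S)
  have o2: "OMap R' (OMap R z) = z" if "z \<in> Obj D" for z
    using arg_cong[OF R'R, of "\<lambda>F. OMap F z"] that by (simp add: comp_funct_def id_funct_def S)
  have a1: "AMap R (AMap R' f) = f" if "f \<in> Arr C" for f
    using arg_cong[OF RR', of "\<lambda>F. AMap F f"] that by (simp add: comp_funct_def id_funct_def S)
  have a2: "AMap R' (AMap R f) = f" if "f \<in> Arr D" for f
    using arg_cong[OF R'R, of "\<lambda>F. AMap F f"] that by (simp add: comp_funct_def id_funct_def S)
  define y where "y = OMap R' x"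
  have y: "y \<in> Obj D" "OMap R y = x" unfolding y_def using functor_obj[OF R' x] o1[OF x] by auto
  note \<eta> = A(2)[OF x] and \<epsilon> = A(3)[OF y(1)]
  define g where "g = AMap R' (Cmp \<eta> x)"
  have Lx: "OMap L x \<in> Obj D" using functor_obj[OF L x] .
  have g: "g \<in> Hom D y (OMap L x)"
    using functor_Hom[OF R' \<eta>] o2[OF Lx] unfolding g_def y_def by simp
  have Rg: "AMap R g = Cmp \<eta> x" unfolding g_def using a1 \<eta> by (simp add: Hom_def)
  have \<epsilon>': "Cmp \<epsilon> y \<in> Hom D (OMap L x) y" using \<epsilon> y by simp
  have "Comp D g (Cmp \<epsilon> y) = Id D (OMap L x)"
    using A(5)[OF g] Rg A(6)[OF x] by simp
  moreover have "Comp D (Cmp \<epsilon> y) g = Id D y"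
  proof -
    have "AMap R (Comp D (Cmp \<epsilon> y) g) = AMap R (Id D y)"
      using functor_Comp[OF R g \<epsilon>'] Rg A(7)[OF y(1)] y functor_Id[OF R y(1)] by simp
    then show ?thesis
      using a2 Comp_Hom[OF D g \<epsilon>'] Id_Hom[OF D y(1)] unfolding Hom_def by (metis (mono_tags, lifting) mem_Collect_eq)
  qed
  ultimately have "iso_arr D g" using iso_arrI[OF g \<epsilon>'] by blast
  then show ?thesis using functor_iso[OF R g] Rg by simp
qed

section \<open>Small categories\<close>

lemma small_image: "small (A :: 'u :: universe set) \<Longrightarrow> small (f ` A :: 'u set)"
  unfolding small_def by (rule lesspoll_trans1[OF image_lepoll])

lemma small_singleton: "small {x :: 'u :: universe}"
  unfolding small_def by (rule finite_lesspoll_infinite[OF infinite_universe]) simp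

lemma small_Un:
  fixes A B :: "'u :: universe set"
  assumes "small A" "small B"
  shows "small (A \<union> B)"
proof -
  obtain a b :: 'u where ab: "a \<noteq> b" using ex_neq_universe by blast
  have "{a, b} \<prec> (UNIV :: 'u set)"
    by (rule finite_lesspoll_infinite[OF infinite_universe]) simp
  then have "small (\<Union>i\<in>{a, b}. if i = a then A else B)"
    using assms by (intro small_Union) (auto simp: small_def)
  also have "(\<Union>i\<in>{a, b}. if i = a then A else B) = A \<union> B" using ab by auto
  finally show ?thesis .
qed

lemma small_insert: "small (A :: 'u :: universe set) \<Longrightarrow> small (insert x A)"
  using small_Un[OF small_singleton, of A x] by simp

lemma decode_code: "inj (code :: 'a \<Rightarrow> 'u :: universe) \<Longrightarrow> decode (code x :: 'u) = (x :: 'a)"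
  unfolding decode_def by simp

lemma Obj_encode: "Obj (encode C) = code ` Obj C"
  and Arr_encode: "Arr (encode C) = code ` Arr C"
  by (simp_all add: encode_def)

lemma Dom_encode: "inj (code :: 'a \<Rightarrow> 'u) \<Longrightarrow> f \<in> Arr C \<Longrightarrow>
      Dom (encode C :: 'u :: universe scat) (code (f :: 'a)) = code (Dom C f)"
  and Cod_encode: "inj (code :: 'a \<Rightarrow> 'u) \<Longrightarrow> f \<in> Arr C \<Longrightarrow>
      Cod (encode C :: 'u :: universe scat) (code (f :: 'a)) = code (Cod C f)"
  and Id_encode: "inj (code :: 'o \<Rightarrow> 'u) \<Longrightarrow> x \<in> Obj C \<Longrightarrow>
      Id (encode C :: 'u :: universe scat) (code (x :: 'o)) = code (Id C x)"
  and Comp_encode: "inj (code :: 'a \<Rightarrow> 'u) \<Longrightarrow> composable C g f \<Longrightarrow>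
      Comp (encode C :: 'u :: universe scat) (code (g :: 'a)) (code f) = code (Comp C g f)"
  by (auto simp: encode_def decode_code composable_def)

lemma Hom_encode:
  fixes C :: "('o, 'a) cat" and f :: 'a
  assumes "inj (code :: 'o \<Rightarrow> 'u)" "inj (code :: 'a \<Rightarrow> 'u)"
  shows "code f \<in> Hom (encode C :: 'u :: universe scat) (code x) (code y) \<longleftrightarrow> f \<in> Hom C x y"
  using assms by (auto simp: Hom_def Arr_encode Dom_encode Cod_encode inj_eq inj_image_mem_iff)

text \<open>
  The raw categories fed into \<open>encode\<close> need not be \<open>undefined\<close> outside their domains; \<open>encode\<close>
  normalises this, so only the genuine category laws have to be checked.
\<close>

lemma category_encode:
  fixes C :: "('o, 'a) cat"
  assumes io: "inj (code :: 'o \<Rightarrow> 'u)" and ia: "inj (code :: 'a \<Rightarrow> 'u)"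
    and ob: "\<And>f. f \<in> Arr C \<Longrightarrow> Dom C f \<in> Obj C \<and> Cod C f \<in> Obj C"
    and id: "\<And>x. x \<in> Obj C \<Longrightarrow> Id C x \<in> Hom C x x"
    and comp: "\<And>g f. composable C g f \<Longrightarrow> Comp C g f \<in> Hom C (Dom C f) (Cod C g)"
    and unit: "\<And>f. f \<in> Arr C \<Longrightarrow> Comp C f (Id C (Dom C f)) = f \<and> Comp C (Id C (Cod C f)) f = f"
    and assoc: "\<And>h g f. composable C h g \<Longrightarrow> composable C g f \<Longrightarrow>
      Comp C (Comp C h g) f = Comp C h (Comp C g f)"
  shows "category (encode C :: 'u :: universe scat)"
proof -
  define E :: "'u scat" where "E = encode C"
  have O: "Obj E = code ` Obj C" and A: "Arr E = code ` Arr C"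
    by (simp_all add: E_def encode_def)
  note [simp] = Dom_encode[OF ia, of _ C, folded E_def] Cod_encode[OF ia, of _ C, folded E_def]
    Id_encode[OF io, of _ C, folded E_def] Comp_encode[OF ia, of C, folded E_def]
  have idm: "Id C x \<in> Arr C" "Dom C (Id C x) = x" "Cod C (Id C x) = x" if "x \<in> Obj C" for x
    using id[OF that] by (auto simp: Hom_def)
  have cE: "composable E (code g) (code f) \<longleftrightarrow> composable C g f" for g f :: 'a
    by (auto simp: composable_def A inj_image_mem_iff[OF ia] inj_eq[OF io])
  have cE': "\<exists>g' f'. g = code g' \<and> f = code f' \<and> composable C g' f'" if c: "composable E g f" for g f :: 'u
  proof -
    obtain g' f' :: 'a where "g = code g'" "f = code f'"
      using c by (auto simp: composable_def A)
    then show ?thesis using c cE by blast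
  qed
  have cm: "Comp C g f \<in> Arr C" "Dom C (Comp C g f) = Dom C f" "Cod C (Comp C g f) = Cod C g"
    if "composable C g f" for g f
    using comp[OF that] by (auto simp: Hom_def)
  have cpid: "composable C f (Id C (Dom C f))" "composable C (Id C (Cod C f)) f" if "f \<in> Arr C" for f
    using that ob[OF that] idm by (auto simp: composable_def)
  have "Comp E g f = undefined" if "\<not> composable E g f" for g f
  proof -
    have "\<not> composable C g' f'" if "g = code g'" "f = code f'" for g' f'
      using that \<open>\<not> composable E g f\<close> cE by blast
    then show ?thesis unfolding E_def encode_def
      by (auto simp: decode_code[OF ia])
  qed
  moreover have "Dom E \<in> extensional (Arr E)" "Cod E \<in> extensional (Arr E)" "Id E \<in> extensional (Obj E)"
    by (simp_all add: E_def encode_def)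
  moreover have "Comp E g f \<in> Hom E (Dom E f) (Cod E g)" if "composable E g f" for g f
    using cE'[OF that] cm by (auto simp: Hom_def A composable_def)
  moreover have "Comp E (Comp E h g) f = Comp E h (Comp E g f)"
    if hg: "composable E h g" and gf: "composable E g f" for h g f
  proof -
    obtain h' g' f' :: 'a where e: "h = code h'" "g = code g'" "f = code f'"
      using hg gf unfolding composable_def A by blast
    have c: "composable C h' g'" "composable C g' f'"
      using hg gf by (simp_all add: e cE)
    have "composable C (Comp C h' g') f'" "composable C h' (Comp C g' f')"
      using c cm by (auto simp: composable_def)
    then show ?thesis using c assoc[OF c] by (simp add: e)
  qed
  ultimately have "category E"
    unfolding category_def PiE_def
    using ob idm unit cpid by (auto simp: O A Hom_def)
  then show ?thesis by (simp add: E_def)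
qed

lemma category_encode_one_arrow:
  fixes C :: "('o, 'a) cat"
  assumes "inj (code :: 'o \<Rightarrow> 'u)" "inj (code :: 'a \<Rightarrow> 'u)"
    and "Obj C = {x}" "Arr C = {f}" "Dom C f = x" "Cod C f = x" "Id C x = f" "Comp C f f = f"
  shows "category (encode C :: 'u :: universe scat)"
  by (rule category_encode[OF assms(1,2)]) (auto simp: assms(3-) Hom_def composable_def)

lemma small_categoryI: "category A \<Longrightarrow> small (Obj A) \<Longrightarrow> small (Arr A) \<Longrightarrow> small_category A"
  by (simp add: small_category_def)

lemma small_functI:
  "functor_from_to u A B \<Longrightarrow> small_category A \<Longrightarrow> small_category B \<Longrightarrow> small_funct u"
  by (auto simp: small_funct_def functor_from_to_def)

subsection \<open>The terminal category\<close>

lemma terminal_cat_simps: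
  "Obj (terminal_cat :: 'u :: universe scat) = {code ()}"
  "Arr (terminal_cat :: 'u :: universe scat) = {code ()}"
  "Dom (terminal_cat :: 'u :: universe scat) (code ()) = code ()"
  "Cod (terminal_cat :: 'u :: universe scat) (code ()) = code ()"
  "Id (terminal_cat :: 'u :: universe scat) (code ()) = code ()"
  "Comp (terminal_cat :: 'u :: universe scat) (code ()) (code ()) = code ()"
  by (simp_all add: terminal_cat_def encode_def composable_def)

lemma small_terminal_cat: "small_category (terminal_cat :: 'u :: universe scat)"
proof (rule small_categoryI)
  show "category (terminal_cat :: 'u scat)"
    unfolding terminal_cat_def
    by (rule category_encode[OF inj_code_unit inj_code_unit]) (auto simp: Hom_def composable_def)
qed (simp_all add: terminal_cat_simps small_singleton)

lemma terminal_category: "category (terminal_cat :: 'u :: universe scat)"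
  by (rule small_terminal_cat[unfolded small_category_def, THEN conjunct1])

lemma pt_functor:
  assumes "category A" "a \<in> Obj A"
  shows "functor_from_to (pt A a) terminal_cat A"
  using assms terminal_category Id_Hom[OF assms] Comp_Id_left[OF assms(1) Id_Hom[OF assms]]
  unfolding functor_from_to_def is_functor_def pt_def
  by (auto simp: terminal_cat_simps Hom_def composable_def)

lemma bang_functor:
  assumes "category A"
  shows "functor_from_to (bang A) A terminal_cat"
proof -
  have "Comp A g f \<in> Arr A" if "composable A g f" for g f
    using assms that unfolding category_def Hom_def by auto
  moreover have "Dom A f \<in> Obj A" "Cod A f \<in> Obj A" if "f \<in> Arr A" for f
    using assms that unfolding category_def by auto
  ultimately show ?thesis
    using assms terminal_category Id_Hom[OF assms]
    unfolding functor_from_to_def is_functor_def bang_def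
    by (auto simp: terminal_cat_simps Hom_def composable_def)
qed

lemma comp_pt:
  assumes u: "functor_from_to u A B" and a: "a \<in> Obj A"
  shows "u \<circ>\<^sub>F pt A a = pt B (OMap u a)"
  using functor_Id[OF u a] u
  by (simp add: comp_funct_def pt_def functor_from_to_def restrict_def fun_eq_iff)

lemma bang_comp:
  assumes u: "functor_from_to u A B"
  shows "bang B \<circ>\<^sub>F u = bang A"
  using u unfolding functor_from_to_def is_functor_def
  by (auto simp: comp_funct_def bang_def restrict_def fun_eq_iff)

lemma bang_pt:
  assumes "category A" "a \<in> Obj A"
  shows "bang A \<circ>\<^sub>F pt A a = id_funct terminal_cat"
  using Id_Hom[OF assms] assms by (auto simp: comp_funct_def bang_def pt_def id_funct_def restrict_def
    fun_eq_iff terminal_cat_simps Hom_def)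

lemma comp_funct_assoc:
  assumes "functor_from_to u A B" "Src v = B"
  shows "(w \<circ>\<^sub>F v) \<circ>\<^sub>F u = w \<circ>\<^sub>F (v \<circ>\<^sub>F u)"
  using assms unfolding functor_from_to_def is_functor_def
  by (auto simp: comp_funct_def restrict_def fun_eq_iff)

lemma one_arrow_pt_bang:
  assumes "Obj J = {z}" "Arr J = {Id J z}"
  shows "pt J z \<circ>\<^sub>F bang J = id_funct J"
  using assms
  by (auto simp: comp_funct_def bang_def pt_def id_funct_def restrict_def fun_eq_iff terminal_cat_simps)

subsection \<open>The cocone\<close>

definition terminal_obj :: "('o, 'a) cat \<Rightarrow> 'o \<Rightarrow> bool" where
  "terminal_obj C t \<longleftrightarrow> t \<in> Obj C \<and> (\<forall>x\<in>Obj C. \<exists>!f. f \<in> Hom C x t)"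

lemma Obj_rcone: "Obj (rcone A) = insert rcone_infty (rcone_obj ` Obj A)"
  by (auto simp: rcone_def Obj_encode rcone_infty_def rcone_obj_def)

text \<open>
  The category of which \<open>rcone A\<close> is the encoding. Arrow computations are done here, by case
  distinction on the datatype of arrows, and transported with \<open>Hom_rcone\<close>.
\<close>

abbreviation raw_rcone :: "'u scat \<Rightarrow> ('u option, ('u, 'u) rcone_arr) cat" where
  "raw_rcone A \<equiv> \<lparr>Obj = insert None (Some ` Obj A),
     Arr = Base ` Arr A \<union> Leg ` Obj A \<union> {Id_infty},
     Dom = rcone_dom A, Cod = rcone_cod A, Id = rcone_id A, Comp = rcone_comp A\<rparr>"

lemma Hom_rcone: "code f \<in> Hom (rcone A) (code x) (code y) \<longleftrightarrow> f \<in> Hom (raw_rcone A) x y"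
  for A :: "'u :: universe scat"
  unfolding rcone_def by (rule Hom_encode[OF inj_code_option inj_code_rcone_arr])

lemma category_rcone:
  assumes A: "category (A :: 'u :: universe scat)"
  shows "category (rcone A)"
proof -
  have ob: "Dom A f \<in> Obj A" "Cod A f \<in> Obj A" if "f \<in> Arr A" for f
    using A that unfolding category_def by auto
  have id: "Id A x \<in> Arr A" "Dom A (Id A x) = x" "Cod A (Id A x) = x" if "x \<in> Obj A" for x
    using Id_Hom[OF A that] by (auto simp: Hom_def)
  have comp: "Comp A g f \<in> Arr A" "Dom A (Comp A g f) = Dom A f" "Cod A (Comp A g f) = Cod A g"
    if "g \<in> Arr A" "f \<in> Arr A" "Dom A g = Cod A f" for g f
    using A that unfolding category_def composable_def Hom_def by auto
  have unit: "Comp A f (Id A (Dom A f)) = f" "Comp A (Id A (Cod A f)) f = f" if "f \<in> Arr A" for f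
    using A that unfolding category_def by auto
  have assoc: "Comp A (Comp A h g) f = Comp A h (Comp A g f)"
    if "h \<in> Arr A" "g \<in> Arr A" "f \<in> Arr A" "Dom A h = Cod A g" "Dom A g = Cod A f" for h g f
    using A that unfolding category_def composable_def by auto
  show ?thesis
    unfolding rcone_def
    by (rule category_encode[OF inj_code_option inj_code_rcone_arr])
      (auto simp: Hom_def composable_def ob id comp unit assoc)
qed

lemma small_rcone:
  assumes A: "small_category (A :: 'u :: universe scat)"
  shows "small_category (rcone A)"
proof (rule small_categoryI)
  have cat: "category A" and sm: "small (Obj A)" "small (Arr A)"
    using A by (auto simp: small_category_def)
  show "category (rcone A)" using category_rcone[OF cat] .
  show "small (Obj (rcone A))" unfolding Obj_rcone using sm by (intro small_insert small_image)
  have "Arr (rcone A) = (\<lambda>f. code (Base f :: ('u, 'u) rcone_arr)) ` Arr A \<union>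
      (rcone_leg ` Obj A \<union> {code (Id_infty :: ('u, 'u) rcone_arr)})"
    by (auto simp: rcone_def Arr_encode rcone_leg_def image_Un image_image)
  then show "small (Arr (rcone A))"
    using sm small_Un small_image small_singleton by metis
qed

lemma rcone_leg_Hom:
  assumes "a \<in> Obj A"
  shows "rcone_leg a \<in> Hom (rcone A) (rcone_obj a) rcone_infty"
  unfolding rcone_leg_def rcone_obj_def rcone_infty_def Hom_rcone
  using assms by (simp add: Hom_def)

lemma rcone_terminal_obj:
  assumes A: "category (A :: 'u :: universe scat)"
  shows "terminal_obj (rcone A) rcone_infty"
proof -
  define r :: "'u option \<Rightarrow> ('u, 'u) rcone_arr" where
    "r x = (case x of None \<Rightarrow> Id_infty | Some a \<Rightarrow> Leg a)" for x
  have "\<exists>!f. f \<in> Hom (rcone A) (code x) (code (None :: 'u option))"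
    if x: "x \<in> insert None (Some ` Obj A)" for x :: "'u option"
  proof (rule ex1I)
    have "r x \<in> Hom (raw_rcone A) x None" using x by (auto simp: r_def Hom_def)
    then show "code (r x) \<in> Hom (rcone A) (code x) (code (None :: 'u option))"
      by (rule Hom_rcone[THEN iffD2])
  next
    fix g assume g: "g \<in> Hom (rcone A) (code x) (code (None :: 'u option))"
    then obtain k :: "('u, 'u) rcone_arr" where k: "g = code k"
      by (auto simp: Hom_def rcone_def Arr_encode)
    have "k \<in> Hom (raw_rcone A) x None"
      by (rule Hom_rcone[THEN iffD1]) (use g k in simp)
    then have "k = r x" by (cases k) (auto simp: r_def Hom_def)
    then show "g = code (r x)" using k by simp
  qed
  then show ?thesis
    unfolding terminal_obj_def rcone_infty_def by (auto simp: rcone_def Obj_encode)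
qed

lemma rcone_incl_functor:
  assumes A: "category (A :: 'u :: universe scat)"
  shows "functor_from_to (rcone_incl A) A (rcone A)"
proof -
  let ?B = "\<lambda>f. code (Base f :: ('u, 'u) rcone_arr) :: 'u"
  have ob: "Dom A f \<in> Obj A" "Cod A f \<in> Obj A" if "f \<in> Arr A" for f
    using A that unfolding category_def by auto
  have hom: "?B f \<in> Hom (rcone A) (rcone_obj (Dom A f)) (rcone_obj (Cod A f))" if "f \<in> Arr A" for f
    unfolding rcone_obj_def Hom_rcone using that by (simp add: Hom_def)
  have id: "?B (Id A x) = Id (rcone A) (rcone_obj x)" if "x \<in> Obj A" for x
    using that by (simp add: rcone_def rcone_obj_def Id_encode[OF inj_code_option])
  have comp: "?B (Comp A g f) = Comp (rcone A) (?B g) (?B f)" if "composable A g f" for g f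
    using that Comp_encode[OF inj_code_rcone_arr, of "raw_rcone A" "Base g" "Base f", folded rcone_def]
    by (simp add: composable_def)
  have ca: "Comp A g f \<in> Arr A" if "composable A g f" for g f
    using A that unfolding category_def Hom_def by auto
  show ?thesis
    unfolding functor_from_to_def is_functor_def rcone_incl_def
    using A category_rcone[OF A] hom ob id comp ca Id_Hom[OF A]
    by (auto simp: Hom_def Obj_rcone composable_def)
qed

subsection \<open>The slice over a base object of the cocone of a discrete category\<close>

lemma discrete_Hom_iff:
  assumes A: "category A" "discrete A" and x: "x \<in> Obj A"
  shows "f \<in> Hom A y x \<longleftrightarrow> y = x \<and> f = Id A x"
proof
  assume f: "f \<in> Hom A y x"
  then have "f = Id A y" using A(2) by (auto simp: discrete_def Hom_def)
  moreover have "Id A y \<in> Hom A y y" using Id_Hom[OF A(1) Hom_objs(1)[OF A(1) f]] .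
  ultimately show "y = x \<and> f = Id A x" using f by (auto simp: Hom_def)
qed (use Id_Hom[OF A(1) x] in auto)

text \<open>
  The inclusion of the base into the cocone is full; together with \<open>discrete_Hom_iff\<close> this
  leaves only the identity over a base object.
\<close>

lemma Hom_rcone_base:
  fixes A :: "'u :: universe scat"
  assumes "f \<in> Hom (rcone A) (rcone_obj a) (rcone_obj b)"
  shows "\<exists>g\<in>Hom A a b. f = code (Base g :: ('u, 'u) rcone_arr)"
proof -
  obtain k :: "('u, 'u) rcone_arr" where k: "f = code k"
    using assms by (auto simp: Hom_def rcone_def Arr_encode)
  then have "k \<in> Hom (raw_rcone A) (Some a) (Some b)"
    by (intro Hom_rcone[THEN iffD1]) (use assms k in \<open>simp add: rcone_obj_def\<close>)
  then show ?thesis using k by (auto simp: Hom_def)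
qed

text \<open>
  Every object of the slice over \<open>s\<close> is an arrow into \<open>s\<close>, hence the identity, so the slice is a
  point and its cell is trivial. This makes Der4 at \<open>s\<close> a statement about the unit.
\<close>

lemma slice_rcone_incl:
  assumes A: "category (A :: 'u :: universe scat)" "discrete A" and s: "s \<in> Obj A"
  defines "u \<equiv> rcone_incl A" and "b \<equiv> rcone_obj s"
  defines "J \<equiv> slice u b" and "x \<equiv> (s, Id (rcone A) b)"
  shows "small_category J"
    and "Obj J = {code x}"
    and "Arr J = {Id J (code x)}"
    and "slice_proj u b = pt A s \<circ>\<^sub>F bang J"
    and "slice_cell u b = id_ntrans (pt (rcone A) b \<circ>\<^sub>F bang J)"
proof -
  have u: "Src u = A" "Tgt u = rcone A" "\<And>a. a \<in> Obj A \<Longrightarrow> OMap u a = rcone_obj a"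
    by (simp_all add: u_def rcone_incl_def)
  note uf = rcone_incl_functor[OF A(1), folded u_def]
  have R: "category (rcone A)" using category_rcone[OF A(1)] .
  have b: "b \<in> Obj (rcone A)" using s by (simp add: b_def Obj_rcone)
  have us: "OMap u s = b" using s u by (simp add: b_def)
  have idb: "Id (rcone A) b = code (Base (Id A s) :: ('u, 'u) rcone_arr)"
    using functor_Id[OF uf s] us Id_Hom[OF A(1) s] by (simp add: u_def rcone_incl_def Hom_def)
  have so: "slice_obj u b = {x}"
  proof -
    have "y = x" if y: "y \<in> slice_obj u b" for y
    proof -
      obtain a f where af: "y = (a, f)" "a \<in> Obj A" "f \<in> Hom (rcone A) (rcone_obj a) (rcone_obj s)"
        using y by (auto simp: slice_obj_def u b_def)
      then obtain g where "g \<in> Hom A a s" "f = code (Base g :: ('u, 'u) rcone_arr)"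
        using Hom_rcone_base by blast
      then show ?thesis using af(1) discrete_Hom_iff[OF A s] idb by (simp add: x_def)
    qed
    moreover have "x \<in> slice_obj u b"
      using Id_Hom[OF R b] us s by (simp add: slice_obj_def x_def u)
    ultimately show ?thesis by blast
  qed
  have sa: "slice_arr u b = {(x, Id A s, x)}"
  proof -
    have "Comp (rcone A) (Id (rcone A) b) (AMap u (Id A s)) = Id (rcone A) b"
      using functor_Id[OF uf s] us Comp_Id_left[OF R Id_Hom[OF R b]] by simp
    then show ?thesis
      unfolding slice_arr_def so using Id_Hom[OF A(1) s]
      by (auto simp: x_def u discrete_Hom_iff[OF A s])
  qed
  let ?T = "triple_cat A {x} {(x, Id A s, x)}"
  have T: "J = encode ?T" by (simp add: J_def slice_def so sa u)
  have ii: "Comp A (Id A s) (Id A s) = Id A s"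
    using Comp_Id_left[OF A(1) Id_Hom[OF A(1) s]] .
  have Tid: "Id ?T x = (x, Id A s, x)" by (simp add: triple_cat_def x_def)
  have "category J"
    unfolding T by (rule category_encode_one_arrow[OF inj_code_pair inj_code_triple, of _ x "(x, Id A s, x)"])
      (simp_all only: Tid, simp_all add: triple_cat_def ii)
  moreover show O: "Obj J = {code x}" by (simp add: T Obj_encode triple_cat_def)
  moreover have Ar: "Arr J = {code (x, Id A s, x)}" by (simp add: T Arr_encode triple_cat_def)
  ultimately show "small_category J" by (simp add: small_category_def small_singleton)
  have "Id J (code x) = code (x, Id A s, x)"
    unfolding T using Id_encode[OF inj_code_pair, of x ?T] Tid by (simp add: triple_cat_def)
  then show "Arr J = {Id J (code x)}" using Ar by simp
  show p: "slice_proj u b = pt A s \<circ>\<^sub>F bang J"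
    unfolding slice_proj_def J_def[symmetric]
    by (auto simp: pt_def comp_funct_def bang_def O Ar u restrict_def fun_eq_iff terminal_cat_simps
        decode_code[OF inj_code_pair] decode_code[OF inj_code_triple] x_def)
  have up: "u \<circ>\<^sub>F slice_proj u b = pt (rcone A) b \<circ>\<^sub>F bang J"
    using p comp_funct_assoc[OF bang_functor[OF \<open>category J\<close>], of "pt A s" u] comp_pt[OF uf s] us
    by (simp add: pt_def)
  show "slice_cell u b = id_ntrans (pt (rcone A) b \<circ>\<^sub>F bang J)"
    unfolding slice_cell_def up id_ntrans_def u(2) J_def[symmetric]
    by (auto simp: pt_def comp_funct_def bang_def O restrict_def fun_eq_iff
        terminal_cat_simps decode_code[OF inj_code_pair] x_def)
qed

subsection \<open>A discrete category as a coproduct of points\<close>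

text \<open>
  Der1 speaks about the encoded coproduct of categories; \<open>\<psi>\<close> identifies the coproduct of points
  indexed by the objects of \<open>S\<close> with \<open>S\<close> itself, the inclusion of the summand \<open>s\<close> becoming the point \<open>s\<close>.
\<close>

lemma discrete_coproduct_of_points:
  assumes S: "small_category (S :: 'u :: universe scat)" "discrete S"
  defines "T \<equiv> sum_cat (Obj S) (\<lambda>_. terminal_cat)"
  shows "\<exists>\<psi> \<psi>'. small_category T \<and> functor_from_to \<psi> T S \<and> functor_from_to \<psi>' S T \<and>
    \<psi> \<circ>\<^sub>F \<psi>' = id_funct S \<and> \<psi>' \<circ>\<^sub>F \<psi> = id_funct T \<and>
    (\<forall>s\<in>Obj S. functor_from_to (sum_incl (Obj S) (\<lambda>_. terminal_cat) s) terminal_cat T \<and>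
      \<psi> \<circ>\<^sub>F sum_incl (Obj S) (\<lambda>_. terminal_cat) s = pt S s)"
proof -
  have A: "category S" and sm: "small (Obj S)" using S by (auto simp: small_category_def)
  let ?e = "\<lambda>s. code (s, code () :: 'u) :: 'u"
  let ?C = "\<lparr>Obj = (SIGMA i:Obj S. {code ()}), Arr = (SIGMA i:Obj S. {code ()}),
     Dom = (\<lambda>(i, f). (i, Dom terminal_cat f)),
     Cod = (\<lambda>(i, f). (i, Cod terminal_cat f)),
     Id = (\<lambda>(i, x). (i, Id terminal_cat x)),
     Comp = (\<lambda>(i, g) (_, f). (i, Comp terminal_cat g f))\<rparr> :: ('u \<times> 'u, 'u \<times> 'u) cat"
  have T: "T = encode ?C" by (simp add: T_def sum_cat_def terminal_cat_simps)
  have catT: "category T"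
    unfolding T by (rule category_encode[OF inj_code_pair inj_code_pair])
      (auto simp: Hom_def composable_def terminal_cat_simps)
  have O: "Obj T = ?e ` Obj S" and Ar: "Arr T = ?e ` Obj S"
    by (auto simp: T Obj_encode Arr_encode)
  have smT: "small_category T"
    using catT O Ar small_image[OF sm] by (intro small_categoryI) auto
  have D: "Dom T (?e s) = ?e s" "Cod T (?e s) = ?e s" "Id T (?e s) = ?e s"
      "Comp T (?e s) (?e s) = ?e s" if "s \<in> Obj S" for s
    using that Dom_encode[OF inj_code_pair, of "(s, code ())" ?C] Cod_encode[OF inj_code_pair, of "(s, code ())" ?C]
      Id_encode[OF inj_code_pair, of "(s, code ())" ?C] Comp_encode[OF inj_code_pair, of ?C "(s, code ())" "(s, code ())"]
    by (simp_all add: T terminal_cat_simps composable_def)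
  have inj_e: "?e s = ?e s' \<longleftrightarrow> s = s'" for s s' :: 'u by (simp add: inj_eq[OF inj_code_pair])
  have dec: "decode (?e s) = (s, code () :: 'u)" for s :: 'u by (simp add: decode_code[OF inj_code_pair])
  have ar: "f \<in> Arr S \<longleftrightarrow> (\<exists>s\<in>Obj S. f = Id S s)" for f
    using S(2) A Id_Hom[OF A] unfolding discrete_def category_def Hom_def by blast
  have idS: "Dom S (Id S s) = s" "Cod S (Id S s) = s" "Id S s \<in> Arr S"
      "Comp S (Id S s) (Id S s) = Id S s" if "s \<in> Obj S" for s
    using Id_Hom[OF A that] Comp_Id_left[OF A Id_Hom[OF A that]] by (auto simp: Hom_def)
  have inj_Id: "Id S s = Id S s' \<longleftrightarrow> s = s'" if "s \<in> Obj S" "s' \<in> Obj S" for s s'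
    using idS(1) that by metis
  define \<psi> where "\<psi> = \<lparr>Src = T, Tgt = S, OMap = (\<lambda>x\<in>Obj T. fst (decode x :: 'u \<times> 'u)),
    AMap = (\<lambda>x\<in>Arr T. Id S (fst (decode x :: 'u \<times> 'u)))\<rparr>"
  define \<psi>' where "\<psi>' = \<lparr>Src = S, Tgt = T, OMap = (\<lambda>s\<in>Obj S. ?e s), AMap = (\<lambda>f\<in>Arr S. ?e (Dom S f))\<rparr>"
  have "functor_from_to \<psi> T S"
    unfolding functor_from_to_def is_functor_def \<psi>_def
    using catT A by (auto simp: O Ar D dec idS composable_def inj_e)
  moreover have "functor_from_to \<psi>' S T"
    unfolding functor_from_to_def is_functor_def \<psi>'_def
    using catT A by (auto simp: O Ar D dec idS composable_def inj_e ar)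
  moreover have "\<psi> \<circ>\<^sub>F \<psi>' = id_funct S"
    by (auto simp: \<psi>_def \<psi>'_def comp_funct_def id_funct_def O Ar dec ar idS inj_Id restrict_def fun_eq_iff)
  moreover have "\<psi>' \<circ>\<^sub>F \<psi> = id_funct T"
    by (auto simp: \<psi>_def \<psi>'_def comp_funct_def id_funct_def O Ar dec ar idS inj_Id restrict_def fun_eq_iff)
  moreover have "functor_from_to (sum_incl (Obj S) (\<lambda>_. terminal_cat) s) terminal_cat T"
    if "s \<in> Obj S" for s
    unfolding functor_from_to_def is_functor_def sum_incl_def T_def[symmetric]
    using that catT terminal_category
    by (auto simp: O Ar D composable_def terminal_cat_simps)
  moreover have "\<psi> \<circ>\<^sub>F sum_incl (Obj S) (\<lambda>_. terminal_cat) s = pt S s" if "s \<in> Obj S" for s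
    using that by (auto simp: \<psi>_def sum_incl_def pt_def comp_funct_def O Ar dec restrict_def
        fun_eq_iff terminal_cat_simps)
  ultimately show ?thesis using smT by blast
qed

section \<open>Calculus in a prederivator\<close>

text \<open>
  Functors between small categories with both ends displayed, so that the type of \<open>u\<^sup>*\<close> can be read
  off a hypothesis and composites need no side condition on sources and targets.
\<close>

definition small_from_to :: "'u :: universe sfunct \<Rightarrow> 'u scat \<Rightarrow> 'u scat \<Rightarrow> bool" where
  "small_from_to u A B \<longleftrightarrow> functor_from_to u A B \<and> small_category A \<and> small_category B"

lemma small_from_toD:
  assumes "small_from_to u A B"
  shows "functor_from_to u A B" "small_category A" "small_category B" "small_funct u"
    "Src u = A" "Tgt u = B"
  using assms small_functI by (auto simp: small_from_to_def functor_from_to_def)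

lemma small_from_to_comp:
  "small_from_to u A B \<Longrightarrow> small_from_to v B C \<Longrightarrow> small_from_to (v \<circ>\<^sub>F u) A C"
  using comp_functor by (auto simp: small_from_to_def)

lemma small_pt: "small_category A \<Longrightarrow> a \<in> Obj A \<Longrightarrow> small_from_to (pt A a) terminal_cat A"
  using pt_functor small_terminal_cat by (auto simp: small_from_to_def small_category_def)

lemma small_bang: "small_category A \<Longrightarrow> small_from_to (bang A) A terminal_cat"
  using bang_functor small_terminal_cat by (auto simp: small_from_to_def small_category_def)

lemma small_id: "small_category A \<Longrightarrow> small_from_to (id_funct A) A A"
  using id_functor by (auto simp: small_from_to_def small_category_def)

lemma small_rcone_incl: "small_category A \<Longrightarrow> small_from_to (rcone_incl A) A (rcone A)"
  using rcone_incl_functor small_rcone by (auto simp: small_from_to_def small_category_def)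

lemma DCat_category: "prederivator D \<Longrightarrow> small_category A \<Longrightarrow> category (DCat D A)"
  unfolding prederivator_def by blast

lemma DFun_functor:
  assumes "prederivator D" "small_from_to u A B"
  shows "functor_from_to (DFun D u) (DCat D B) (DCat D A)"
  using assms(1) small_from_toD[OF assms(2)] unfolding prederivator_def by blast

lemma DFun_id: "prederivator D \<Longrightarrow> small_category A \<Longrightarrow> DFun D (id_funct A) = id_funct (DCat D A)"
  unfolding prederivator_def by blast

lemma DFun_comp:
  assumes "prederivator D" "small_from_to u A B" "small_from_to v B C"
  shows "DFun D (v \<circ>\<^sub>F u) = DFun D u \<circ>\<^sub>F DFun D v"
  using assms(1) small_from_toD[OF assms(2)] small_from_toD[OF assms(3)]
  unfolding prederivator_def by metis

lemma DFun_comp_obj: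
  assumes D: "prederivator D" "small_from_to u A B" "small_from_to v B C" and X: "X \<in> Obj (DCat D C)"
  shows "OMap (DFun D u) (OMap (DFun D v) X) = OMap (DFun D (v \<circ>\<^sub>F u)) X"
  using DFun_comp[OF D] DFun_functor[OF D(1,3)] X by (simp add: comp_funct_def functor_from_to_def)

lemma DFun_comp_arr:
  assumes D: "prederivator D" "small_from_to u A B" "small_from_to v B C"
    and f: "f \<in> Hom (DCat D C) X Y"
  shows "AMap (DFun D u) (AMap (DFun D v) f) = AMap (DFun D (v \<circ>\<^sub>F u)) f"
  using DFun_comp[OF D] DFun_functor[OF D(1,3)] f
  by (simp add: comp_funct_def functor_from_to_def Hom_def)

lemma DFun_id_obj:
  "prederivator D \<Longrightarrow> small_category A \<Longrightarrow> X \<in> Obj (DCat D A) \<Longrightarrow> OMap (DFun D (id_funct A)) X = X"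
  by (simp add: DFun_id) (simp add: id_funct_def)

lemma DFun_id_arr:
  "prederivator D \<Longrightarrow> small_category A \<Longrightarrow> f \<in> Hom (DCat D A) X Y \<Longrightarrow>
    AMap (DFun D (id_funct A)) f = f"
  by (simp add: DFun_id) (simp add: id_funct_def Hom_def)

lemma DNat_ntrans:
  "prederivator D \<Longrightarrow> small_ntrans \<alpha> \<Longrightarrow>
    ntrans_from_to (DNat D \<alpha>) (DFun D (NSrc \<alpha>)) (DFun D (NTgt \<alpha>))"
  unfolding prederivator_def by blast

lemma DNat_id:
  assumes "prederivator D" "small_from_to u A B" "X \<in> Obj (DCat D B)"
  shows "Cmp (DNat D (id_ntrans u)) X = Id (DCat D A) (OMap (DFun D u) X)"
proof -
  have "DNat D (id_ntrans u) = id_ntrans (DFun D u)"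
    using assms(1) small_from_toD(4)[OF assms(2)] unfolding prederivator_def by blast
  then show ?thesis
    using DFun_functor[OF assms(1,2)] assms(3) by (simp add: id_ntrans_def functor_from_to_def)
qed

lemma DNat_hcomp:
  "prederivator D \<Longrightarrow> small_ntrans \<alpha> \<Longrightarrow> small_ntrans \<beta> \<Longrightarrow> Tgt (NSrc \<alpha>) = Src (NSrc \<beta>) \<Longrightarrow>
    DNat D (hcomp \<beta> \<alpha>) = hcomp (DNat D \<alpha>) (DNat D \<beta>)"
  unfolding prederivator_def by blast

lemma small_ntransI:
  assumes "small_from_to F A B" "small_from_to G A B" "NSrc \<alpha> = F" "NTgt \<alpha> = G"
    and "Cmp \<alpha> \<in> extensional (Obj A)"
    and "\<And>x. x \<in> Obj A \<Longrightarrow> Cmp \<alpha> x \<in> Hom B (OMap F x) (OMap G x)"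
    and "\<And>f x y. f \<in> Hom A x y \<Longrightarrow> Comp B (AMap G f) (Cmp \<alpha> x) = Comp B (Cmp \<alpha> y) (AMap F f)"
  shows "small_ntrans \<alpha>"
  using small_from_toD[OF assms(1)] small_from_toD[OF assms(2)] assms(3-)
  unfolding small_ntrans_def is_ntrans_def by (auto simp: functor_from_to_def Hom_def)

lemma small_id_ntrans:
  assumes u: "small_from_to u A B"
  shows "small_ntrans (id_ntrans u)"
proof (rule small_ntransI[OF u u])
  note F = small_from_toD[OF u]
  have B: "category B" using F(3) by (simp add: small_category_def)
  show "Cmp (id_ntrans u) \<in> extensional (Obj A)" by (simp add: id_ntrans_def F)
  show "Cmp (id_ntrans u) x \<in> Hom B (OMap u x) (OMap u x)" if "x \<in> Obj A" for x
    using Id_Hom[OF B functor_obj[OF F(1) that]] that by (simp add: id_ntrans_def F)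
  fix f x y assume f: "f \<in> Hom A x y"
  have "x \<in> Obj A" "y \<in> Obj A" using Hom_objs[OF functor_cats(1)[OF F(1)] f] by auto
  then show "Comp B (AMap u f) (Cmp (id_ntrans u) x) = Comp B (Cmp (id_ntrans u) y) (AMap u f)"
    using Comp_Id_left[OF B functor_Hom[OF F(1) f]] Comp_Id_right[OF B functor_Hom[OF F(1) f]]
    by (simp add: id_ntrans_def F)
qed (simp_all add: id_ntrans_def)

lemma small_pt_arr:
  assumes A: "small_category A" and g: "g \<in> Hom A a b"
  shows "small_ntrans (pt_arr A g)"
proof -
  have C: "category A" using A by (simp add: small_category_def)
  have ab: "a \<in> Obj A" "b \<in> Obj A" using Hom_objs[OF C g] by auto
  show ?thesis
    by (rule small_ntransI[OF small_pt[OF A ab(1)] small_pt[OF A ab(2)]])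
      (use g Comp_Id_left[OF C g] Comp_Id_right[OF C g] in
        \<open>auto simp: pt_arr_def pt_def terminal_cat_simps Hom_def\<close>)
qed

text \<open>
  Whiskering is horizontal composition with an identity, so the 2-functoriality of \<open>D\<close> computes it.
  As \<open>D\<close> reverses functors, a whiskering on the source side acts on \<open>D \<alpha>\<close> by applying \<open>u\<^sup>*\<close>, and one
  on the target side by evaluating at \<open>v\<^sup>* X\<close>.
\<close>

lemma DNat_whisker_source:
  assumes D: "prederivator D" and \<alpha>: "small_ntrans \<alpha>" "NSrc \<alpha> = F" "NTgt \<alpha> = G"
    and FG: "small_from_to F A B" "small_from_to G A B" and u: "small_from_to u C A"
    and X: "X \<in> Obj (DCat D B)"
  shows "Cmp (DNat D (hcomp \<alpha> (id_ntrans u))) X = AMap (DFun D u) (Cmp (DNat D \<alpha>) X)"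
proof -
  have "DNat D (hcomp \<alpha> (id_ntrans u)) = hcomp (DNat D (id_ntrans u)) (DNat D \<alpha>)"
    using DNat_hcomp[OF D small_id_ntrans[OF u] \<alpha>(1)] small_from_toD[OF u] small_from_toD[OF FG(1)] \<alpha>
    by (simp add: id_ntrans_def)
  moreover have N: "NSrc (DNat D \<alpha>) = DFun D F" "NTgt (DNat D \<alpha>) = DFun D G"
    and t: "ntrans_from_to (DNat D \<alpha>) (DFun D F) (DFun D G)"
    using DNat_ntrans[OF D \<alpha>(1)] \<alpha>(2,3) by (auto simp: ntrans_from_to_def)
  moreover have I: "NSrc (DNat D (id_ntrans u)) = DFun D u"
    using DNat_ntrans[OF D small_id_ntrans[OF u]] by (simp add: ntrans_from_to_def id_ntrans_def)
  moreover note f = DFun_functor[OF D FG(1)] DFun_functor[OF D FG(2)] DFun_functor[OF D u]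
  ultimately show ?thesis
    using X DNat_id[OF D u functor_obj[OF f(2) X]]
      Comp_Id_left[OF functor_cats(2)[OF f(3)] functor_Hom[OF f(3) ntrans_Hom[OF t f(1) X]]]
    by (simp add: hcomp_def functor_from_to_def)
qed

lemma DNat_whisker_target:
  assumes D: "prederivator D" and \<alpha>: "small_ntrans \<alpha>" "NSrc \<alpha> = F" "NTgt \<alpha> = G"
    and FG: "small_from_to F A B" "small_from_to G A B" and v: "small_from_to v B C"
    and X: "X \<in> Obj (DCat D C)"
  shows "Cmp (DNat D (hcomp (id_ntrans v) \<alpha>)) X = Cmp (DNat D \<alpha>) (OMap (DFun D v) X)"
proof -
  have "DNat D (hcomp (id_ntrans v) \<alpha>) = hcomp (DNat D \<alpha>) (DNat D (id_ntrans v))"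
    using DNat_hcomp[OF D \<alpha>(1) small_id_ntrans[OF v]] small_from_toD[OF v] small_from_toD[OF FG(1)] \<alpha>
    by (simp add: id_ntrans_def)
  moreover have N: "NSrc (DNat D \<alpha>) = DFun D F" "NTgt (DNat D \<alpha>) = DFun D G"
    and t: "ntrans_from_to (DNat D \<alpha>) (DFun D F) (DFun D G)"
    using DNat_ntrans[OF D \<alpha>(1)] \<alpha>(2,3) by (auto simp: ntrans_from_to_def)
  moreover have I: "NSrc (DNat D (id_ntrans v)) = DFun D v" "NTgt (DNat D (id_ntrans v)) = DFun D v"
    using DNat_ntrans[OF D small_id_ntrans[OF v]] by (simp_all add: ntrans_from_to_def id_ntrans_def)
  moreover note f = DFun_functor[OF D FG(1)] DFun_functor[OF D v]
  moreover note vX = functor_obj[OF f(2) X]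
  ultimately show ?thesis
    using X DNat_id[OF D v X] functor_Id[OF f(1) vX]
      Comp_Id_right[OF functor_cats(2)[OF f(1)] ntrans_Hom[OF t f(1) vX]]
    by (simp add: hcomp_def functor_from_to_def)
qed

section \<open>Evaluation at a terminal object\<close>

text \<open>
  The unit of the adjunction between the projection \<open>B \<rightarrow> 1\<close> and the point \<open>t\<close>: its component at \<open>x\<close> is
  the only arrow from \<open>x\<close> to the terminal object.
\<close>

definition terminal_cell :: "'u :: universe scat \<Rightarrow> 'u \<Rightarrow> 'u sntrans" where
  "terminal_cell B t =
    \<lparr>NSrc = id_funct B, NTgt = pt B t \<circ>\<^sub>F bang B, Cmp = (\<lambda>x\<in>Obj B. THE f. f \<in> Hom B x t)\<rparr>"

lemma terminal_cell_Cmp: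
  assumes "terminal_obj B t" "category B" "f \<in> Hom B x t"
  shows "Cmp (terminal_cell B t) x = f"
proof -
  have x: "x \<in> Obj B" using Hom_objs[OF assms(2,3)] by auto
  then have "\<exists>!f. f \<in> Hom B x t" using assms(1) by (simp add: terminal_obj_def)
  then have "(THE f. f \<in> Hom B x t) = f" using assms(3) by (rule the1_equality)
  then show ?thesis using x by (simp add: terminal_cell_def)
qed

lemma terminal_unique:
  fixes B :: "'u :: universe scat"
  assumes "terminal_obj B t" "category B" "f \<in> Hom B x t" "g \<in> Hom B x t"
  shows "f = g"
  using terminal_cell_Cmp[OF assms(1,2,3)] terminal_cell_Cmp[OF assms(1,2,4)] by simp

lemma small_terminal_cell:
  assumes B: "small_category B" and t: "terminal_obj B t"
  shows "small_ntrans (terminal_cell B t)"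
proof -
  have C: "category B" using B by (simp add: small_category_def)
  have tB: "t \<in> Obj B" using t by (simp add: terminal_obj_def)
  note ptb = small_from_to_comp[OF small_bang[OF B] small_pt[OF B tB]]
  have o: "OMap (pt B t \<circ>\<^sub>F bang B) x = t" if "x \<in> Obj B" for x
    using that by (simp add: comp_funct_def pt_def bang_def terminal_cat_simps)
  have h: "Cmp (terminal_cell B t) x \<in> Hom B x t" if x: "x \<in> Obj B" for x
  proof -
    obtain f where "f \<in> Hom B x t" using t x unfolding terminal_obj_def by blast
    then show ?thesis using terminal_cell_Cmp[OF t C] by metis
  qed
  show ?thesis
  proof (rule small_ntransI[OF small_id[OF B] ptb])
    show "Cmp (terminal_cell B t) x \<in> Hom B (OMap (id_funct B) x) (OMap (pt B t \<circ>\<^sub>F bang B) x)"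
      if "x \<in> Obj B" for x using h[OF that] o[OF that] that by (simp add: id_funct_def)
    fix f x y assume f: "f \<in> Hom B x y"
    have xy: "x \<in> Obj B" "y \<in> Obj B" using Hom_objs[OF C f] by auto
    have "AMap (pt B t \<circ>\<^sub>F bang B) f \<in> Hom B t t"
      using functor_Hom[OF small_from_toD(1)[OF ptb] f] o xy by simp
    then show "Comp B (AMap (pt B t \<circ>\<^sub>F bang B) f) (Cmp (terminal_cell B t) x) =
        Comp B (Cmp (terminal_cell B t) y) (AMap (id_funct B) f)"
      using terminal_unique[OF t C Comp_Hom[OF C h[OF xy(1)]] Comp_Hom[OF C f h[OF xy(2)]]] f
      by (simp add: id_funct_def Hom_def)
  qed (simp_all add: terminal_cell_def)
qed

text \<open>
  Together with \<open>terminal_cell_bang\<close> this contains the triangle identities for the adjunction: take \<open>g\<close>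
  to be the identity of \<open>t\<close>. For the other points it shows that the image of the cell under \<open>D\<close>
  consists of the legs of the underlying diagram.
\<close>

lemma terminal_cell_at_point:
  assumes B: "small_category B" and t: "terminal_obj B t" and g: "g \<in> Hom B a t"
  shows "hcomp (terminal_cell B t) (id_ntrans (pt B a)) = pt_arr B g"
proof -
  have C: "category B" using B by (simp add: small_category_def)
  have ob: "a \<in> Obj B" "t \<in> Obj B" using Hom_objs[OF C g] by auto
  note ptb = comp_functor[OF bang_functor[OF C] pt_functor[OF C ob(2)]]
  have o: "OMap (pt B t \<circ>\<^sub>F bang B) a = t"
    using ob by (simp add: comp_funct_def pt_def bang_def terminal_cat_simps)
  show ?thesis
  proof (rule ntrans_eqI)
    show "NSrc (hcomp (terminal_cell B t) (id_ntrans (pt B a))) = NSrc (pt_arr B g)"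
      using comp_pt[OF id_functor[OF C] ob(1)] g ob
      by (simp add: hcomp_def id_ntrans_def terminal_cell_def pt_arr_def id_funct_def Hom_def)
    show "NTgt (hcomp (terminal_cell B t) (id_ntrans (pt B a))) = NTgt (pt_arr B g)"
      using comp_pt[OF ptb ob(1)] o g
      by (simp add: hcomp_def id_ntrans_def terminal_cell_def pt_arr_def Hom_def)
    show "Cmp (hcomp (terminal_cell B t) (id_ntrans (pt B a))) \<in> extensional (Obj terminal_cat)"
      by (simp add: hcomp_def id_ntrans_def pt_def)
    show "Cmp (pt_arr B g) \<in> extensional (Obj terminal_cat)" by (simp add: pt_arr_def)
    show "Cmp (hcomp (terminal_cell B t) (id_ntrans (pt B a))) x = Cmp (pt_arr B g) x"
      if "x \<in> Obj terminal_cat" for x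
      using that ob Id_Hom[OF C ob(1)] terminal_cell_Cmp[OF t C g] Comp_Id_right[OF C g]
      by (simp add: hcomp_def id_ntrans_def pt_arr_def pt_def terminal_cat_simps id_funct_def Hom_def
          terminal_cell_def)
  qed
qed

lemma terminal_cell_bang:
  assumes B: "small_category B" and t: "terminal_obj B t"
  shows "hcomp (id_ntrans (bang B)) (terminal_cell B t) = id_ntrans (bang B)"
proof -
  have C: "category B" using B by (simp add: small_category_def)
  have tB: "t \<in> Obj B" using t by (simp add: terminal_obj_def)
  note ptb = comp_functor[OF bang_functor[OF C] pt_functor[OF C tB]]
  have h: "Cmp (terminal_cell B t) x \<in> Arr B" if x: "x \<in> Obj B" for x
  proof -
    obtain f where "f \<in> Hom B x t" using t x unfolding terminal_obj_def by blast
    then show ?thesis using terminal_cell_Cmp[OF t C] by (auto simp: Hom_def)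
  qed
  show ?thesis
  proof (rule ntrans_eqI)
    show "NSrc (hcomp (id_ntrans (bang B)) (terminal_cell B t)) = NSrc (id_ntrans (bang B))"
      using bang_comp[OF id_functor[OF C]] by (simp add: hcomp_def id_ntrans_def terminal_cell_def)
    show "NTgt (hcomp (id_ntrans (bang B)) (terminal_cell B t)) = NTgt (id_ntrans (bang B))"
      using bang_comp[OF ptb] by (simp add: hcomp_def id_ntrans_def terminal_cell_def)
    show "Cmp (hcomp (id_ntrans (bang B)) (terminal_cell B t)) \<in> extensional (Obj B)"
      by (simp add: hcomp_def terminal_cell_def id_funct_def)
    show "Cmp (id_ntrans (bang B)) \<in> extensional (Obj B)" by (simp add: id_ntrans_def bang_def)
    show "Cmp (hcomp (id_ntrans (bang B)) (terminal_cell B t)) x = Cmp (id_ntrans (bang B)) x"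
      if x: "x \<in> Obj B" for x
    proof -
      have "OMap (pt B t \<circ>\<^sub>F bang B) x \<in> Obj B" using functor_obj[OF ptb x] .
      then show ?thesis
        using x h[OF x]
        by (simp add: hcomp_def id_ntrans_def bang_def terminal_cat_simps)
           (simp add: terminal_cell_def id_funct_def bang_def[symmetric])
    qed
  qed
qed

text \<open>
  The image under \<open>D\<close> of the adjunction between \<open>B \<rightarrow> 1\<close> and \<open>t\<close>. Its unit is \<open>\<alpha>\<close>, and its counit is an
  identity because \<open>B \<rightarrow> 1\<close> after \<open>t\<close> is the identity functor; the transpose of \<open>k\<close> is therefore just
  \<open>t\<^sup>* k\<close>.
\<close>

lemma evaluation_at_terminal_adjunction:
  assumes D: "prederivator D" and B: "small_category B" and t: "terminal_obj B t"
    and X: "X \<in> Obj (DCat D B)" and y: "y \<in> Obj (DCat D terminal_cat)"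
  defines "\<alpha> \<equiv> Cmp (DNat D (terminal_cell B t)) X"
    and "P \<equiv> DFun D (bang B)" and "ev \<equiv> \<lambda>a. DFun D (pt B a)"
  shows "h \<in> Hom (DCat D terminal_cat) (OMap (ev t) X) y \<Longrightarrow>
      Comp (DCat D B) (AMap P h) \<alpha> \<in> Hom (DCat D B) X (OMap P y)"
    and "h \<in> Hom (DCat D terminal_cat) (OMap (ev t) X) y \<Longrightarrow> g \<in> Hom B a t \<Longrightarrow>
      AMap (ev a) (Comp (DCat D B) (AMap P h) \<alpha>) =
      Comp (DCat D terminal_cat) h (Cmp (DNat D (pt_arr B g)) X)"
    and "h \<in> Hom (DCat D terminal_cat) (OMap (ev t) X) y \<Longrightarrow>
      AMap (ev t) (Comp (DCat D B) (AMap P h) \<alpha>) = h"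
    and "k \<in> Hom (DCat D B) X (OMap P y) \<Longrightarrow>
      AMap (ev t) k \<in> Hom (DCat D terminal_cat) (OMap (ev t) X) y"
    and "k \<in> Hom (DCat D B) X (OMap P y) \<Longrightarrow>
      Comp (DCat D B) (AMap P (AMap (ev t) k)) \<alpha> = k"
proof -
  let ?E = "DCat D terminal_cat" and ?B = "DCat D B"
  have C: "category B" using B by (simp add: small_category_def)
  have tB: "t \<in> Obj B" using t by (simp add: terminal_obj_def)
  note sb = small_bang[OF B] and spt = small_pt[OF B]
  note ptb = small_from_to_comp[OF sb spt[OF tB]]
  note P = DFun_functor[OF D sb, folded P_def]
  have ev: "functor_from_to (ev a) ?B ?E" if "a \<in> Obj B" for a
    unfolding ev_def using DFun_functor[OF D spt[OF that]] .
  note CB = DCat_category[OF D B] and CE = DCat_category[OF D small_terminal_cat]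
  note \<tau> = small_terminal_cell[OF B t]
  have \<tau>st: "NSrc (terminal_cell B t) = id_funct B" "NTgt (terminal_cell B t) = pt B t \<circ>\<^sub>F bang B"
    by (simp_all add: terminal_cell_def)
  note fI = DFun_functor[OF D small_id[OF B]]
  have nt: "ntrans_from_to (DNat D (terminal_cell B t)) (DFun D (id_funct B)) (DFun D (pt B t \<circ>\<^sub>F bang B))"
    using DNat_ntrans[OF D \<tau>] \<tau>st by simp
  have evP: "OMap (ev a) (OMap P z) = z" if "a \<in> Obj B" "z \<in> Obj ?E" for a z
    unfolding ev_def P_def
    using DFun_comp_obj[OF D spt[OF that(1)] sb that(2)] bang_pt[OF C that(1)]
      DFun_id_obj[OF D small_terminal_cat that(2)] by simp
  have evPa: "AMap (ev a) (AMap P f) = f" if "a \<in> Obj B" "f \<in> Hom ?E z w" for a f z w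
    unfolding ev_def P_def
    using DFun_comp_arr[OF D spt[OF that(1)] sb that(2)] bang_pt[OF C that(1)]
      DFun_id_arr[OF D small_terminal_cat that(2)] by simp
  have \<alpha>Z: "Cmp (DNat D (terminal_cell B t)) Z \<in> Hom ?B Z (OMap P (OMap (ev t) Z))"
    if "Z \<in> Obj ?B" for Z
    using ntrans_Hom[OF nt fI that] DFun_id_obj[OF D B that] DFun_comp_obj[OF D sb spt[OF tB] that]
    by (simp add: P_def ev_def)
  have \<alpha>: "\<alpha> \<in> Hom ?B X (OMap P (OMap (ev t) X))" unfolding \<alpha>_def using \<alpha>Z[OF X] .
  have leg: "AMap (ev a) \<alpha> = Cmp (DNat D (pt_arr B g)) X" if g: "g \<in> Hom B a t" for a g
  proof -
    have a: "a \<in> Obj B" using Hom_objs[OF C g] by simp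
    show ?thesis
      unfolding \<alpha>_def ev_def
      using DNat_whisker_source[OF D \<tau> \<tau>st small_id[OF B] ptb spt[OF a] X]
        terminal_cell_at_point[OF B t g] by simp
  qed
  have "pt_arr B (Id B t) = id_ntrans (pt B t)"
    using Id_Hom[OF C tB] by (auto simp: pt_arr_def id_ntrans_def Hom_def)
       (auto simp: pt_def restrict_def fun_eq_iff)
  then have t\<alpha>: "AMap (ev t) \<alpha> = Id ?E (OMap (ev t) X)"
    using leg[OF Id_Hom[OF C tB]] DNat_id[OF D spt[OF tB] X] by (simp add: ev_def)
  \<comment> \<open>On a constant diagram the unit is an identity; naturality of the unit then yields the last claim.\<close>
  have const: "Cmp (DNat D (terminal_cell B t)) (OMap P y) = Id ?B (OMap P y)"
    using DNat_whisker_target[OF D \<tau> \<tau>st small_id[OF B] ptb sb y] terminal_cell_bang[OF B t]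
      DNat_id[OF D sb y] by (simp add: P_def)
  show k: "Comp ?B (AMap P h) \<alpha> \<in> Hom ?B X (OMap P y)"
    if h: "h \<in> Hom ?E (OMap (ev t) X) y" for h
    using Comp_Hom[OF CB \<alpha> functor_Hom[OF P h]] .
  show leg': "AMap (ev a) (Comp ?B (AMap P h) \<alpha>) = Comp ?E h (Cmp (DNat D (pt_arr B g)) X)"
    if h: "h \<in> Hom ?E (OMap (ev t) X) y" and g: "g \<in> Hom B a t" for h a g
  proof -
    have a: "a \<in> Obj B" using Hom_objs[OF C g] by simp
    show ?thesis
      using functor_Comp[OF ev[OF a] \<alpha> functor_Hom[OF P h]] evPa[OF a h] leg[OF g]
      by simp
  qed
  show "AMap (ev t) (Comp ?B (AMap P h) \<alpha>) = h" if h: "h \<in> Hom ?E (OMap (ev t) X) y" for h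
    using functor_Comp[OF ev[OF tB] \<alpha> functor_Hom[OF P h]] evPa[OF tB h] t\<alpha>
      Comp_Id_right[OF CE h] by simp
  assume kk: "k \<in> Hom ?B X (OMap P y)"
  show tk: "AMap (ev t) k \<in> Hom ?E (OMap (ev t) X) y"
    using functor_Hom[OF ev[OF tB] kk] evP[OF tB y] by simp
  have "Comp ?B (AMap P (AMap (ev t) k)) \<alpha> = Comp ?B (Cmp (DNat D (terminal_cell B t)) (OMap P y)) k"
    using ntrans_natural[OF nt fI kk] DFun_id_arr[OF D B kk] DFun_comp_arr[OF D sb spt[OF tB] kk]
    by (simp add: P_def ev_def \<alpha>_def)
  then show "Comp ?B (AMap P (AMap (ev t) k)) \<alpha> = k"
    using const Comp_Id_left[OF CB kk] by simp
qed

section \<open>Diagrams on a discrete category\<close>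

text \<open>
  Der1 for the coproduct of points makes \<open>D(S) \<rightarrow> \<Prod>\<^sub>s D(1)\<close> an equivalence up to the isomorphism
  \<open>\<psi>\<close>, and an equivalence is fully faithful.
\<close>

lemma discrete_arrows_pointwise:
  assumes D: "derivator D" and S: "small_category S" "discrete S"
    and WV: "W \<in> Obj (DCat D S)" "V \<in> Obj (DCat D S)"
    and f: "\<And>s. s \<in> Obj S \<Longrightarrow>
      f s \<in> Hom (DCat D terminal_cat) (OMap (DFun D (pt S s)) W) (OMap (DFun D (pt S s)) V)"
  shows "\<exists>!m. m \<in> Hom (DCat D S) W V \<and> (\<forall>s\<in>Obj S. AMap (DFun D (pt S s)) m = f s)"
proof -
  have pre: "prederivator D" and der1: "Der1 D" using D by (auto simp: derivator_def)
  let ?T = "sum_cat (Obj S) (\<lambda>_. terminal_cat)"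
  let ?inc = "sum_incl (Obj S) (\<lambda>_. terminal_cat)"
  let ?E = "DCat D terminal_cat"
  obtain \<psi> \<psi>' where T: "small_category ?T" and \<psi>: "functor_from_to \<psi> ?T S" "functor_from_to \<psi>' S ?T"
      "\<psi> \<circ>\<^sub>F \<psi>' = id_funct S" "\<psi>' \<circ>\<^sub>F \<psi> = id_funct ?T"
    and inc: "\<And>s. s \<in> Obj S \<Longrightarrow> functor_from_to (?inc s) terminal_cat ?T"
      "\<And>s. s \<in> Obj S \<Longrightarrow> \<psi> \<circ>\<^sub>F ?inc s = pt S s"
    using discrete_coproduct_of_points[OF S] by blast
  have s\<psi>: "small_from_to \<psi> ?T S" "small_from_to \<psi>' S ?T"
    using \<psi> T S(1) by (simp_all add: small_from_to_def)
  have sinc: "small_from_to (?inc s) terminal_cat ?T" if "s \<in> Obj S" for s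
    using inc(1)[OF that] T small_terminal_cat by (simp add: small_from_to_def)
  note f\<psi> = DFun_functor[OF pre s\<psi>(1)] and f\<psi>' = DFun_functor[OF pre s\<psi>(2)]
  note finc = DFun_functor[OF pre sinc]
  define F where "F = tuple_funct (DCat D ?T) (Obj S) (\<lambda>s. DFun D (?inc s))"
  have eqF: "is_equivalence F"
    unfolding F_def
    by (rule der1[unfolded Der1_def, rule_format])
      (use S(1) in \<open>simp add: small_terminal_cat small_category_def[of S]\<close>)
  define Q where "Q = prod_cat (Obj S) (\<lambda>s. Tgt (DFun D (?inc s)))"
  have F: "functor_from_to F (DCat D ?T) Q"
    using eqF by (simp add: is_equivalence_def functor_from_to_def F_def tuple_funct_def Q_def)
  have Tg: "Tgt (DFun D (?inc s)) = ?E" if "s \<in> Obj S" for s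
    using finc[OF that] by (simp add: functor_from_to_def)
  define W' where "W' = OMap (DFun D \<psi>) W"
  define V' where "V' = OMap (DFun D \<psi>) V"
  have WV': "W' \<in> Obj (DCat D ?T)" "V' \<in> Obj (DCat D ?T)"
    unfolding W'_def V'_def using functor_obj[OF f\<psi>] WV by auto
  have restored: "OMap (DFun D \<psi>') W' = W" "OMap (DFun D \<psi>') V' = V"
    unfolding W'_def V'_def
    using DFun_comp_obj[OF pre s\<psi>(2,1) WV(1)] DFun_comp_obj[OF pre s\<psi>(2,1) WV(2)] \<psi>(3)
      DFun_id_obj[OF pre S(1) WV(1)] DFun_id_obj[OF pre S(1) WV(2)] by simp_all
  have ptW: "OMap (DFun D (?inc s)) W' = OMap (DFun D (pt S s)) W"
      "OMap (DFun D (?inc s)) V' = OMap (DFun D (pt S s)) V" if "s \<in> Obj S" for s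
    unfolding W'_def V'_def
    using DFun_comp_obj[OF pre sinc[OF that] s\<psi>(1)] WV inc(2)[OF that] by simp_all
  have pt\<psi>: "AMap (DFun D (?inc s)) (AMap (DFun D \<psi>) m) = AMap (DFun D (pt S s)) m"
    if "s \<in> Obj S" "m \<in> Hom (DCat D S) A A'" for s m A A'
    using DFun_comp_arr[OF pre sinc[OF that(1)] s\<psi>(1) that(2)] inc(2)[OF that(1)] by simp
  have \<psi>\<psi>': "AMap (DFun D \<psi>) (AMap (DFun D \<psi>') n) = n" if "n \<in> Hom (DCat D ?T) A A'" for n A A'
    using DFun_comp_arr[OF pre s\<psi> that] \<psi>(4) DFun_id_arr[OF pre T that] by simp
  have \<psi>'\<psi>: "AMap (DFun D \<psi>') (AMap (DFun D \<psi>) m) = m" if "m \<in> Hom (DCat D S) A A'" for m A A'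
    using DFun_comp_arr[OF pre s\<psi>(2,1) that] \<psi>(3) DFun_id_arr[OF pre S(1) that] by simp
  define g where "g = (\<lambda>s\<in>Obj S. f s)"
  have gA: "g \<in> (\<Pi>\<^sub>E s\<in>Obj S. Arr (Tgt (DFun D (?inc s))))"
    using f unfolding g_def by (auto simp: Tg Hom_def)
  have g: "g \<in> Hom Q (OMap F W') (OMap F V')"
  proof -
    have "Dom Q g = OMap F W'" "Cod Q g = OMap F V'"
      using gA f WV' ptW
      by (auto simp: Q_def prod_cat_def F_def tuple_funct_def g_def Tg Hom_def restrict_def fun_eq_iff)
    then show ?thesis using gA by (simp add: Hom_def Q_def prod_cat_def)
  qed
  have AF: "AMap F n = g \<longleftrightarrow> (\<forall>s\<in>Obj S. AMap (DFun D (?inc s)) n = f s)"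
    if "n \<in> Hom (DCat D ?T) W' V'" for n
    using that by (auto simp: F_def tuple_funct_def g_def Hom_def restrict_def fun_eq_iff)
  obtain n where n: "n \<in> Hom (DCat D ?T) W' V'" "AMap F n = g"
    and uniq: "\<And>n'. n' \<in> Hom (DCat D ?T) W' V' \<Longrightarrow> AMap F n' = g \<Longrightarrow> n' = n"
    using equivalence_fully_faithful[OF F eqF WV' g] by blast
  show ?thesis
  proof (rule ex1I, intro conjI ballI)
    let ?m = "AMap (DFun D \<psi>') n"
    show m: "?m \<in> Hom (DCat D S) W V" using functor_Hom[OF f\<psi>' n(1)] restored by simp
    show "AMap (DFun D (pt S s)) ?m = f s" if s: "s \<in> Obj S" for s
      using pt\<psi>[OF s m] \<psi>\<psi>'[OF n(1)] AF[OF n(1)] n(2) s by simp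
    fix m assume a: "m \<in> Hom (DCat D S) W V \<and> (\<forall>s\<in>Obj S. AMap (DFun D (pt S s)) m = f s)"
    then have mH: "m \<in> Hom (DCat D S) W V" by simp
    have n': "AMap (DFun D \<psi>) m \<in> Hom (DCat D ?T) W' V'"
      using functor_Hom[OF f\<psi> mH] by (simp add: W'_def V'_def)
    then have "AMap (DFun D \<psi>) m = n"
      using a pt\<psi>[OF _ mH] AF[OF n'] by (intro uniq) auto
    then show "m = ?m" using \<psi>'\<psi>[OF mH] by simp
  qed
qed

section \<open>The left Kan extension along the inclusion into the cocone\<close>

lemma lan_adjunction:
  assumes D: "derivator D" and u: "small_from_to u A B"
  shows "adjunction (lan D u) (DFun D u) (lan_unit D u) (lan_counit D u)"
    and "functor_from_to (lan D u) (DCat D A) (DCat D B)"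
proof -
  have pre: "prederivator D" and "Der3 D" using D by (auto simp: derivator_def)
  then have "has_left_adjoint (DFun D u)"
    using small_from_toD[OF u] unfolding Der3_def by blast
  then have "\<exists>p. (case p of (L, \<eta>, \<epsilon>) \<Rightarrow> adjunction L (DFun D u) \<eta> \<epsilon>)"
    unfolding has_left_adjoint_def by auto
  then have "case left_adjoint (DFun D u) of (L, \<eta>, \<epsilon>) \<Rightarrow> adjunction L (DFun D u) \<eta> \<epsilon>"
    unfolding left_adjoint_def by (rule someI_ex)
  then show adj: "adjunction (lan D u) (DFun D u) (lan_unit D u) (lan_counit D u)"
    by (simp add: lan_def lan_unit_def lan_counit_def split: prod.splits)
  show "functor_from_to (lan D u) (DCat D A) (DCat D B)"
    using adj DFun_functor[OF pre u] unfolding adjunction_def functor_from_to_def by simp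
qed

text \<open>
  By Der2 it suffices to treat a single \<open>s\<close>. The slice \<open>J\<close> over \<open>s\<close> is a point, so the cell in the mate
  is an identity and the mate is the adjoint transpose, along \<open>colim\<^sub>J \<stileturn> \<pi>\<^sup>*\<close>, of the unit restricted
  to \<open>J\<close>. Since \<open>\<pi>\<^sup>*\<close> is invertible, a transpose is an isomorphism exactly when the original arrow is.
\<close>

lemma lan_unit_iso_discrete:
  assumes D: "derivator D" and S: "small_category S" "discrete S" and W: "W \<in> Obj (DCat D S)"
  shows "iso_arr (DCat D S) (Cmp (lan_unit D (rcone_incl S)) W)"
proof -
  have pre: "prederivator D" and der2: "Der2 D" and der4: "Der4 D"
    using D by (auto simp: derivator_def)
  have C: "category S" using S(1) by (simp add: small_category_def)
  let ?E = "DCat D terminal_cat"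
  define u where "u = rcone_incl S"
  have u: "small_from_to u S (rcone S)" unfolding u_def using small_rcone_incl[OF S(1)] .
  note u' = small_from_toD[OF u]
  define \<eta> where "\<eta> = Cmp (lan_unit D u) W"
  define X where "X = OMap (lan D u) W"
  note lan = lan_adjunction[OF D u]
  note fu = DFun_functor[OF pre u]
  have \<eta>: "\<eta> \<in> Hom (DCat D S) W (OMap (DFun D u) X)"
    unfolding \<eta>_def X_def using adj_unit_Hom[OF lan W] .
  have X: "X \<in> Obj (DCat D (rcone S))" unfolding X_def using functor_obj[OF lan(2) W] .
  have "iso_arr ?E (AMap (DFun D (pt S s)) \<eta>)" if s: "s \<in> Obj S" for s
  proof -
    define b where "b = rcone_obj s"
    define J where "J = slice u b"
    define z :: 'a where "z = code (s, Id (rcone S) b)"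
    have b: "b \<in> Obj (rcone S)" using s by (simp add: b_def Obj_rcone)
    note sl = slice_rcone_incl[OF C S(2) s, folded u_def b_def, folded J_def z_def]
    have J: "small_category J" "category J" using sl(1) by (auto simp: small_category_def)
    have z: "z \<in> Obj J" using sl(2) by simp
    note sJ = small_bang[OF J(1)]
    have zJ: "pt J z \<circ>\<^sub>F bang J = id_funct J" using one_arrow_pt_bang[OF sl(2,3)] .
    have Jz: "bang J \<circ>\<^sub>F pt J z = id_funct terminal_cat" using bang_pt[OF J(2) z] .
    note ps = small_pt[OF S(1) s] and pb = small_pt[OF small_rcone[OF S(1)] b] and pz = small_pt[OF J(1) z]
    note adj = lan_adjunction[OF D sJ]
    let ?R = "DFun D (bang J)"
    have p: "small_from_to (slice_proj u b) J S"
      using small_from_to_comp[OF sJ ps] sl(4) by simp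
    \<comment> \<open>The point of \<open>J\<close> and the projection to 1 are inverse functors, hence so are their restrictions.\<close>
    have unit: "iso_arr (DCat D J) (Cmp (lan_unit D (bang J)) Y)" if Y: "Y \<in> Obj (DCat D J)" for Y
      using unit_iso_of_right_adjoint_invertible[OF adj DFun_functor[OF pre pz] _ _ Y]
        DFun_comp[OF pre sJ pz] DFun_comp[OF pre pz sJ] zJ Jz DFun_id[OF pre J(1)]
        DFun_id[OF pre small_terminal_cat] by simp
    define y where "y = OMap (DFun D (pt (rcone S) b)) X"
    have y: "y \<in> Obj ?E" unfolding y_def using functor_obj[OF DFun_functor[OF pre pb] X] .
    have ubp: "u \<circ>\<^sub>F pt S s = pt (rcone S) b"
      using comp_pt[OF u'(1) s] s by (simp add: u_def rcone_incl_def b_def)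
    have sy: "OMap (DFun D (pt S s)) (OMap (DFun D u) X) = y"
      unfolding y_def using DFun_comp_obj[OF pre ps u X] ubp by simp
    let ?f = "AMap (DFun D (slice_proj u b)) \<eta>"
    have f_eq: "?f = AMap ?R (AMap (DFun D (pt S s)) \<eta>)"
      using DFun_comp_arr[OF pre sJ ps \<eta>] sl(4) by simp
    define Y where "Y = OMap (DFun D (slice_proj u b)) W"
    have Y: "Y \<in> Obj (DCat D J)" unfolding Y_def using functor_obj[OF DFun_functor[OF pre p] W] .
    have f: "?f \<in> Hom (DCat D J) Y (OMap ?R y)"
      using functor_Hom[OF DFun_functor[OF pre p] \<eta>]
        DFun_comp_obj[OF pre sJ ps functor_obj[OF fu X]] sl(4) sy by (simp add: Y_def)
    define \<theta> where "\<theta> = Comp ?E (Cmp (lan_counit D (bang J)) y) (AMap (lan D (bang J)) ?f)"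
    have \<theta>H: "\<theta> \<in> Hom ?E (OMap (lan D (bang J)) Y) y"
      unfolding \<theta>_def
      using Comp_Hom[OF functor_cats(2)[OF adj(2)] functor_Hom[OF adj(2) f] adj_counit_Hom[OF adj y]] .
    have mate: "is_niso (mate_colim D u b)" using der4 u' b unfolding Der4_def by simp
    have N: "NSrc (lan_unit D u) = id_funct (DCat D S)" "Src (lan D u) = DCat D S"
        "Tgt (lan D (bang J)) = ?E" "Src (DFun D (slice_proj u b)) = DCat D S"
        "NSrc (lan_counit D (bang J)) = lan D (bang J) \<circ>\<^sub>F ?R"
      using lan adj DFun_functor[OF pre p]
      by (simp_all add: adjunction_def ntrans_from_to_def functor_from_to_def)
    note pbJ = small_from_to_comp[OF sJ pb]
    \<comment> \<open>Two of the three factors of the mate survive: the middle one is the image of an identity.\<close>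
    have cell: "Src (NSrc (DNat D (slice_cell u b))) = DCat D (rcone S)"
        "Cmp (DNat D (slice_cell u b)) X = Id (DCat D J) (OMap ?R y)"
      using DNat_ntrans[OF pre small_id_ntrans[OF pbJ]] DFun_functor[OF pre pbJ] sl(5)
        DNat_id[OF pre pbJ X] DFun_comp_obj[OF pre sJ pb X]
      by (simp_all add: ntrans_from_to_def functor_from_to_def id_ntrans_def y_def)
    have src: "Src (NSrc (mate_colim D u b)) = DCat D S" "Tgt (NSrc (mate_colim D u b)) = ?E"
      unfolding mate_colim_def J_def[symmetric]
      by (simp_all add: vcomp_def lwhisk_def comp_funct_def N id_funct_def)
    have "AMap (lan D (bang J)) (Id (DCat D J) (OMap ?R y)) = Id ?E (OMap (lan D (bang J)) (OMap ?R y))"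
      using functor_Id[OF adj(2) functor_obj[OF DFun_functor[OF pre sJ] y]] .
    then have mid: "Comp ?E (AMap (lan D (bang J)) (Id (DCat D J) (OMap ?R y))) (AMap (lan D (bang J)) ?f) =
        AMap (lan D (bang J)) ?f"
      using Comp_Id_left[OF functor_cats(2)[OF adj(2)] functor_Hom[OF adj(2) f]] by simp
    have \<eta>A: "\<eta> \<in> Arr (DCat D S)" using \<eta> by (simp add: Hom_def)
    have "Cmp (mate_colim D u b) W = Comp ?E (Cmp (lan_counit D (bang J)) y)
        (Comp ?E (AMap (lan D (bang J)) (Cmp (DNat D (slice_cell u b)) X)) (AMap (lan D (bang J)) ?f))"
      unfolding mate_colim_def J_def[symmetric]
      using W X \<eta>A by (simp add: vcomp_def rwhisk_def lwhisk_def comp_funct_def N cell(1) u'(6) id_funct_def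
          X_def[symmetric] y_def[symmetric] \<eta>_def[symmetric])
    then have "Cmp (mate_colim D u b) W = \<theta>" unfolding \<theta>_def by (simp add: cell(2) mid)
    then have "iso_arr ?E \<theta>" using mate W src unfolding is_niso_def by auto
    then have R\<theta>: "iso_arr (DCat D J) (AMap ?R \<theta>)"
      using functor_iso[OF DFun_functor[OF pre sJ] \<theta>H] by blast
    \<comment> \<open>Transposing the mate back recovers the unit restricted to \<open>J\<close>.\<close>
    have "?f = Comp (DCat D J) (AMap ?R \<theta>) (Cmp (lan_unit D (bang J)) Y)"
      unfolding \<theta>_def using transpose_of_transpose[OF adj Y y f] by simp
    then have "iso_arr (DCat D J) ?f"
      using iso_Comp[OF functor_cats(1)[OF adj(2)] adj_unit_Hom[OF adj Y] unit[OF Y]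
          functor_Hom[OF DFun_functor[OF pre sJ] \<theta>H] R\<theta>] by simp
    \<comment> \<open>Evaluation at the only object of \<open>J\<close> leads back from \<open>J\<close> to the point \<open>s\<close>.\<close>
    then have "iso_arr ?E (AMap (DFun D (pt J z)) ?f)"
      using functor_iso[OF DFun_functor[OF pre pz] f] by simp
    moreover have "AMap (DFun D (pt J z)) ?f = AMap (DFun D (pt S s)) \<eta>"
    proof -
      note s\<eta> = functor_Hom[OF DFun_functor[OF pre ps] \<eta>]
      show ?thesis
        using DFun_comp_arr[OF pre pz sJ s\<eta>] Jz DFun_id_arr[OF pre small_terminal_cat s\<eta>] f_eq by simp
    qed
    ultimately show ?thesis by simp
  qed
  moreover have "\<eta> \<in> Arr (DCat D S)" using \<eta> by (simp add: Hom_def)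
  ultimately show ?thesis using der2 S(1) unfolding Der2_def \<eta>_def u_def by blast
qed

section \<open>Coproduct cocones\<close>

text \<open>
  Let \<open>\<phi> : i\<^sub>! Y \<rightarrow> X\<close> be an isomorphism. The unit at \<open>Y\<close> followed by \<open>i\<^sup>* \<phi>\<close> is an isomorphism
  \<open>e : Y \<rightarrow> i\<^sup>* X\<close> which inherits the universal property of the unit: every \<open>Y \<rightarrow> i\<^sup>* Z\<close> is \<open>i\<^sup>* k\<close> after \<open>e\<close>
  for a unique \<open>k : X \<rightarrow> Z\<close>. Cancelling \<open>e\<close> gives the claim.
\<close>

lemma colimiting_cocone_restriction_bijective:
  assumes D: "derivator D" and S: "small_category S" "discrete S" and X: "colimiting_cocone D S X"
    and Z: "Z \<in> Obj (DCat D (rcone S))"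
    and m: "m \<in> Hom (DCat D S) (OMap (DFun D (rcone_incl S)) X) (OMap (DFun D (rcone_incl S)) Z)"
  shows "\<exists>!k. k \<in> Hom (DCat D (rcone S)) X Z \<and> AMap (DFun D (rcone_incl S)) k = m"
proof -
  have pre: "prederivator D" using D by (simp add: derivator_def)
  let ?R = "DCat D (rcone S)" and ?S = "DCat D S" and ?i = "DFun D (rcone_incl S)"
  note si = small_rcone_incl[OF S(1)]
  note i = DFun_functor[OF pre si] and lan = lan_adjunction[OF D si]
  note CR = functor_cats(1)[OF i] and CS = functor_cats(2)[OF i]
  obtain Y \<phi> where Y: "Y \<in> Obj ?S" and \<phi>: "\<phi> \<in> Hom ?R (OMap (lan D (rcone_incl S)) Y) X" "iso_arr ?R \<phi>"
    using X unfolding colimiting_cocone_def isomorphic_def by blast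
  obtain \<phi>' where \<phi>': "\<phi>' \<in> Hom ?R X (OMap (lan D (rcone_incl S)) Y)"
      "Comp ?R \<phi>' \<phi> = Id ?R (OMap (lan D (rcone_incl S)) Y)"
    using iso_arr_inverse[OF \<phi>] by blast
  define \<eta> where "\<eta> = Cmp (lan_unit D (rcone_incl S)) Y"
  have \<eta>: "\<eta> \<in> Hom ?S Y (OMap ?i (OMap (lan D (rcone_incl S)) Y))" "iso_arr ?S \<eta>"
    unfolding \<eta>_def using adj_unit_Hom[OF lan Y] lan_unit_iso_discrete[OF D S Y] by auto
  note i\<phi> = functor_Hom[OF i \<phi>(1)]
  define e where "e = Comp ?S (AMap ?i \<phi>) \<eta>"
  have e: "e \<in> Hom ?S Y (OMap ?i X)" "iso_arr ?S e"
    unfolding e_def using Comp_Hom[OF CS \<eta>(1) i\<phi>] iso_Comp[OF CS \<eta> i\<phi> functor_iso[OF i \<phi>]] by auto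
  have ek: "Comp ?S (AMap ?i (Comp ?R k \<phi>)) \<eta> = Comp ?S (AMap ?i k) e" if k: "k \<in> Hom ?R X Z" for k
    using functor_Comp[OF i \<phi>(1) k] Comp_assoc[OF CS \<eta>(1) i\<phi> functor_Hom[OF i k]]
    by (simp add: e_def)
  obtain l where l: "l \<in> Hom ?R (OMap (lan D (rcone_incl S)) Y) Z"
      "Comp ?S (AMap ?i l) \<eta> = Comp ?S m e"
    and uniq: "\<And>l'. l' \<in> Hom ?R (OMap (lan D (rcone_incl S)) Y) Z \<Longrightarrow>
      Comp ?S (AMap ?i l') \<eta> = Comp ?S m e \<Longrightarrow> l' = l"
    using unit_universal[OF lan Y Z Comp_Hom[OF CS e(1) m]] unfolding \<eta>_def by blast
  show ?thesis
  proof (rule ex1I, intro conjI)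
    let ?k = "Comp ?R l \<phi>'"
    show k: "?k \<in> Hom ?R X Z" using Comp_Hom[OF CR \<phi>'(1) l(1)] .
    have "Comp ?R ?k \<phi> = l"
      using Comp_assoc[OF CR \<phi>(1) \<phi>'(1) l(1)] \<phi>'(2) Comp_Id_right[OF CR l(1)] by simp
    then have "Comp ?S (AMap ?i ?k) e = Comp ?S m e" using ek[OF k] l(2) by simp
    then show km: "AMap ?i ?k = m" using iso_epi[OF CS e functor_Hom[OF i k] m] by blast
    fix k' assume k': "k' \<in> Hom ?R X Z \<and> AMap ?i k' = m"
    then have kH: "k' \<in> Hom ?R X Z" by simp
    have "Comp ?R k' \<phi> = l" using uniq[OF Comp_Hom[OF CR \<phi>(1) kH]] ek[OF kH] k' by simp
    with \<open>Comp ?R ?k \<phi> = l\<close> show "k' = ?k" using iso_epi[OF CR \<phi> kH k] by simp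
  qed
qed

lemma dia_obj: "a \<in> Obj A \<Longrightarrow> OMap (dia D A X) a = OMap (DFun D (pt A a)) X"
  and dia_arr: "g \<in> Arr A \<Longrightarrow> AMap (dia D A X) g = Cmp (DNat D (pt_arr A g)) X"
  by (simp_all add: dia_def)

text \<open>
  The hypothesis is applied to the constant diagrams \<open>Z = P\<^sup>* y\<close>. A family \<open>f s : X\<^sub>s \<rightarrow> y\<close> is first
  assembled into an arrow \<open>m : i\<^sup>* X \<rightarrow> i\<^sup>* Z\<close>, then extended to \<open>k : X \<rightarrow> Z\<close>, and the value of \<open>k\<close> at \<open>\<infinity>\<close>
  is the required arrow.
\<close>

lemma coproduct_of_restriction_bijective:
  assumes D: "derivator D" and S: "small_category S" "discrete S"
    and X: "X \<in> Obj (DCat D (rcone S))"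
    and bij: "\<And>Z m. Z \<in> Obj (DCat D (rcone S)) \<Longrightarrow>
      m \<in> Hom (DCat D S) (OMap (DFun D (rcone_incl S)) X) (OMap (DFun D (rcone_incl S)) Z) \<Longrightarrow>
      \<exists>!k. k \<in> Hom (DCat D (rcone S)) X Z \<and> AMap (DFun D (rcone_incl S)) k = m"
  shows "is_coproduct (DCat D terminal_cat) (Obj S)
      (\<lambda>s. OMap (dia D (rcone S) X) (rcone_obj s))
      (OMap (dia D (rcone S) X) rcone_infty)
      (\<lambda>s. AMap (dia D (rcone S) X) (rcone_leg s))"
proof -
  have pre: "prederivator D" using D by (simp add: derivator_def)
  have C: "category S" using S(1) by (simp add: small_category_def)
  let ?R = "DCat D (rcone S)" and ?S = "DCat D S" and ?E = "DCat D terminal_cat"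
  let ?i = "DFun D (rcone_incl S)"
  let ?ev = "\<lambda>a. DFun D (pt (rcone S) a)"
  note sR = small_rcone[OF S(1)] and si = small_rcone_incl[OF S(1)]
  note i = DFun_functor[OF pre si]
  have t: "terminal_obj (rcone S) rcone_infty" using rcone_terminal_obj[OF C] .
  have tR: "rcone_infty \<in> Obj (rcone S)" and oR: "\<And>s. s \<in> Obj S \<Longrightarrow> rcone_obj s \<in> Obj (rcone S)"
    by (auto simp: Obj_rcone)
  note leg = rcone_leg_Hom[of _ S]
  have ev: "functor_from_to (?ev a) ?R ?E" if "a \<in> Obj (rcone S)" for a
    using DFun_functor[OF pre small_pt[OF sR that]] .
  have legA: "rcone_leg s \<in> Arr (rcone S)" if "s \<in> Obj S" for s using leg[OF that] by (simp add: Hom_def)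
  have \<iota>: "Cmp (DNat D (pt_arr (rcone S) (rcone_leg s))) X \<in>
      Hom ?E (OMap (?ev (rcone_obj s)) X) (OMap (?ev rcone_infty) X)" if s: "s \<in> Obj S" for s
  proof -
    have "NSrc (pt_arr (rcone S) (rcone_leg s)) = pt (rcone S) (rcone_obj s)"
      "NTgt (pt_arr (rcone S) (rcone_leg s)) = pt (rcone S) rcone_infty"
      using leg[OF s] by (simp_all add: pt_arr_def Hom_def)
    then show ?thesis
      using ntrans_Hom[OF DNat_ntrans[OF pre small_pt_arr[OF sR leg[OF s]]] _ X] ev[OF oR[OF s]] by simp
  qed
  have i_pt: "rcone_incl S \<circ>\<^sub>F pt S s = pt (rcone S) (rcone_obj s)" if "s \<in> Obj S" for s
    using comp_pt[OF small_from_toD(1)[OF si] that] that by (simp add: rcone_incl_def)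
  have so: "OMap (DFun D (pt S s)) (OMap ?i Z) = OMap (?ev (rcone_obj s)) Z"
    if "s \<in> Obj S" "Z \<in> Obj ?R" for s Z
    using DFun_comp_obj[OF pre small_pt[OF S(1) that(1)] si that(2)] i_pt[OF that(1)] by simp
  have sa: "AMap (DFun D (pt S s)) (AMap ?i k) = AMap (?ev (rcone_obj s)) k"
    if "s \<in> Obj S" "k \<in> Hom ?R Z Z'" for s k Z Z'
    using DFun_comp_arr[OF pre small_pt[OF S(1) that(1)] si that(2)] i_pt[OF that(1)] by simp
  have evP: "OMap (?ev a) (OMap (DFun D (bang (rcone S))) y) = y"
    if "a \<in> Obj (rcone S)" "y \<in> Obj ?E" for a y
    using DFun_comp_obj[OF pre small_pt[OF sR that(1)] small_bang[OF sR] that(2)]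
      bang_pt[OF category_rcone[OF C] that(1)] DFun_id_obj[OF pre small_terminal_cat that(2)] by simp
  have main: "\<exists>!h. h \<in> Hom ?E (OMap (?ev rcone_infty) X) y \<and>
      (\<forall>s\<in>Obj S. Comp ?E h (Cmp (DNat D (pt_arr (rcone S) (rcone_leg s))) X) = f s)"
    if y: "y \<in> Obj ?E" and f: "\<And>s. s \<in> Obj S \<Longrightarrow> f s \<in> Hom ?E (OMap (?ev (rcone_obj s)) X) y" for y f
  proof -
    define Z where "Z = OMap (DFun D (bang (rcone S))) y"
    have Z: "Z \<in> Obj ?R" unfolding Z_def using functor_obj[OF DFun_functor[OF pre small_bang[OF sR]] y] .
    note adj = evaluation_at_terminal_adjunction[OF pre sR t X y, folded Z_def]
    let ?T = "\<lambda>h. Comp ?R (AMap (DFun D (bang (rcone S))) h) (Cmp (DNat D (terminal_cell (rcone S) rcone_infty)) X)"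
    have "f s \<in> Hom ?E (OMap (DFun D (pt S s)) (OMap ?i X)) (OMap (DFun D (pt S s)) (OMap ?i Z))"
      if "s \<in> Obj S" for s
      using f[OF that] so[OF that X] so[OF that Z] evP[OF oR[OF that] y] by (simp add: Z_def)
    then obtain m where m: "m \<in> Hom ?S (OMap ?i X) (OMap ?i Z)"
        "\<And>s. s \<in> Obj S \<Longrightarrow> AMap (DFun D (pt S s)) m = f s"
      and m_uniq: "\<And>m'. m' \<in> Hom ?S (OMap ?i X) (OMap ?i Z) \<Longrightarrow>
        (\<And>s. s \<in> Obj S \<Longrightarrow> AMap (DFun D (pt S s)) m' = f s) \<Longrightarrow> m' = m"
      using discrete_arrows_pointwise[OF D S functor_obj[OF i X] functor_obj[OF i Z], of f] by blast
    obtain k where k: "k \<in> Hom ?R X Z" "AMap ?i k = m"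
      and k_uniq: "\<And>k'. k' \<in> Hom ?R X Z \<Longrightarrow> AMap ?i k' = m \<Longrightarrow> k' = k"
      using bij[OF Z m(1)] by blast
    show ?thesis
    proof (rule ex1I, intro conjI ballI)
      let ?h = "AMap (?ev rcone_infty) k"
      show h: "?h \<in> Hom ?E (OMap (?ev rcone_infty) X) y" using adj(4)[OF k(1)] .
      show "Comp ?E ?h (Cmp (DNat D (pt_arr (rcone S) (rcone_leg s))) X) = f s" if s: "s \<in> Obj S" for s
        using adj(2)[OF h leg[OF s]] adj(5)[OF k(1)] sa[OF s k(1)] k(2) m(2)[OF s] by simp
      fix h' assume "h' \<in> Hom ?E (OMap (?ev rcone_infty) X) y \<and>
        (\<forall>s\<in>Obj S. Comp ?E h' (Cmp (DNat D (pt_arr (rcone S) (rcone_leg s))) X) = f s)"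
      then have h': "h' \<in> Hom ?E (OMap (?ev rcone_infty) X) y"
        "\<And>s. s \<in> Obj S \<Longrightarrow> Comp ?E h' (Cmp (DNat D (pt_arr (rcone S) (rcone_leg s))) X) = f s" by auto
      note Th = adj(1)[OF h'(1)]
      have "AMap ?i (?T h') = m"
        using adj(2)[OF h'(1) leg] h'(2) sa[OF _ Th]
        by (intro m_uniq functor_Hom[OF i Th]) simp
      then have "?T h' = k" using k_uniq[OF Th] by simp
      then show "h' = ?h" using adj(3)[OF h'(1)] by simp
    qed
  qed
  show ?thesis
    unfolding is_coproduct_def
    using functor_obj[OF ev[OF oR] X] functor_obj[OF ev[OF tR] X] \<iota> main
    by (simp add: dia_obj dia_arr oR tR legA)
qed

theorem proposition7p1:
  fixes D :: "('u :: universe, 'o, 'm) prederiv"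
    and S :: "'u scat"
    and X :: 'o
  assumes "derivator D"
    and "small_category S"
    and "discrete S"
    and "X \<in> Obj (DCat D (rcone S))"
  shows "colimiting_cocone D S X \<longleftrightarrow>
    is_coproduct (DCat D terminal_cat) (Obj S)
      (\<lambda>s. OMap (dia D (rcone S) X) (rcone_obj s))
      (OMap (dia D (rcone S) X) rcone_infty)
      (\<lambda>s. AMap (dia D (rcone S) X) (rcone_leg s))"
    (is "_ \<longleftrightarrow> ?coproduct X")
proof
  note D = assms(1) and S = assms(2,3) and X = assms(4)
  have to_coproduct: "?coproduct Z" if Z: "colimiting_cocone D S Z" for Z
  proof (rule coproduct_of_restriction_bijective[OF D S])
    show "Z \<in> Obj (DCat D (rcone S))" using Z by (simp add: colimiting_cocone_def)
  qed (rule colimiting_cocone_restriction_bijective[OF D S Z])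
  then show "colimiting_cocone D S X \<Longrightarrow> ?coproduct X" .
  assume cop: "?coproduct X"
  have pre: "prederivator D" and der2: "Der2 D" using D by (auto simp: derivator_def)
  have C: "category S" using S(1) by (simp add: small_category_def)
  let ?R = "DCat D (rcone S)" and ?E = "DCat D terminal_cat" and ?i = "DFun D (rcone_incl S)"
  let ?ev = "\<lambda>a. DFun D (pt (rcone S) a)"
  note sR = small_rcone[OF S(1)] and si = small_rcone_incl[OF S(1)]
  note i = DFun_functor[OF pre si] and lan = lan_adjunction[OF D si]
  note CR = functor_cats(1)[OF i] and CS = functor_cats(2)[OF i]
  have tR: "rcone_infty \<in> Obj (rcone S)" and oR: "\<And>s. s \<in> Obj S \<Longrightarrow> rcone_obj s \<in> Obj (rcone S)"
    by (auto simp: Obj_rcone)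
  have ev: "functor_from_to (?ev a) ?R ?E" if "a \<in> Obj (rcone S)" for a
    using DFun_functor[OF pre small_pt[OF sR that]] .
  note CE = functor_cats(2)[OF ev[OF tR]]
  have iX: "OMap ?i X \<in> Obj (DCat D S)" using functor_obj[OF i X] .
  define X' where "X' = OMap (lan D (rcone_incl S)) (OMap ?i X)"
  have X': "X' \<in> Obj ?R" unfolding X'_def using functor_obj[OF lan(2) iX] .
  define \<epsilon> where "\<epsilon> = Cmp (lan_counit D (rcone_incl S)) X"
  have \<epsilon>: "\<epsilon> \<in> Hom ?R X' X" unfolding \<epsilon>_def X'_def using adj_counit_Hom[OF lan X] .
  \<comment> \<open>The unit at \<open>i\<^sup>* X\<close> is invertible and \<open>i\<^sup>* \<epsilon>\<close> is a left inverse of it.\<close>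
  have i\<epsilon>: "iso_arr (DCat D S) (AMap ?i \<epsilon>)"
  proof (rule retraction_of_iso[OF CS adj_unit_Hom[OF lan iX]])
    show "iso_arr (DCat D S) (Cmp (lan_unit D (rcone_incl S)) (OMap ?i X))"
      using lan_unit_iso_discrete[OF D S iX] .
    show "AMap ?i \<epsilon> \<in> Hom (DCat D S) (OMap ?i (OMap (lan D (rcone_incl S)) (OMap ?i X))) (OMap ?i X)"
      using functor_Hom[OF i \<epsilon>] by (simp add: X'_def)
    show "Comp (DCat D S) (AMap ?i \<epsilon>) (Cmp (lan_unit D (rcone_incl S)) (OMap ?i X)) =
        Id (DCat D S) (OMap ?i X)"
      unfolding \<epsilon>_def using adj_triangle_R[OF lan X] .
  qed
  have base: "iso_arr ?E (AMap (?ev (rcone_obj s)) \<epsilon>)" if s: "s \<in> Obj S" for s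
  proof -
    have "rcone_incl S \<circ>\<^sub>F pt S s = pt (rcone S) (rcone_obj s)"
      using comp_pt[OF small_from_toD(1)[OF si] s] s by (simp add: rcone_incl_def)
    then show ?thesis
      using functor_iso[OF DFun_functor[OF pre small_pt[OF S(1) s]] functor_Hom[OF i \<epsilon>] i\<epsilon>]
        DFun_comp_arr[OF pre small_pt[OF S(1) s] si \<epsilon>] by simp
  qed
  have "colimiting_cocone D S X'"
    unfolding colimiting_cocone_def isomorphic_def
    using X' iX Id_Hom[OF CR X'] iso_arrI[OF Id_Hom[OF CR X'] Id_Hom[OF CR X']]
      Comp_Id_left[OF CR Id_Hom[OF CR X']] unfolding X'_def by blast
  then have cop': "?coproduct X'" by (rule to_coproduct)
  \<comment> \<open>Naturality of the legs makes the counit a map of coproduct cocones.\<close>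
  have infty: "iso_arr ?E (AMap (?ev rcone_infty) \<epsilon>)"
  proof (rule coproduct_comparison_iso[OF CE cop' cop, where g = "\<lambda>s. AMap (?ev (rcone_obj s)) \<epsilon>"])
    show "AMap (?ev rcone_infty) \<epsilon> \<in> Hom ?E (OMap (dia D (rcone S) X') rcone_infty)
        (OMap (dia D (rcone S) X) rcone_infty)"
      using functor_Hom[OF ev[OF tR] \<epsilon>] by (simp add: dia_obj tR)
    fix s assume s: "s \<in> Obj S"
    note leg = rcone_leg_Hom[OF s]
    show "AMap (?ev (rcone_obj s)) \<epsilon> \<in> Hom ?E (OMap (dia D (rcone S) X') (rcone_obj s))
        (OMap (dia D (rcone S) X) (rcone_obj s))"
      using functor_Hom[OF ev[OF oR[OF s]] \<epsilon>] by (simp add: dia_obj oR s)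
    show "iso_arr ?E (AMap (?ev (rcone_obj s)) \<epsilon>)" using base[OF s] .
    have st: "NSrc (pt_arr (rcone S) (rcone_leg s)) = pt (rcone S) (rcone_obj s)"
      "NTgt (pt_arr (rcone S) (rcone_leg s)) = pt (rcone S) rcone_infty"
      using leg by (simp_all add: pt_arr_def Hom_def)
    have "rcone_leg s \<in> Arr (rcone S)" using leg by (simp add: Hom_def)
    then show "Comp ?E (AMap (?ev rcone_infty) \<epsilon>) (AMap (dia D (rcone S) X') (rcone_leg s)) =
        Comp ?E (AMap (dia D (rcone S) X) (rcone_leg s)) (AMap (?ev (rcone_obj s)) \<epsilon>)"
      using ntrans_natural[OF DNat_ntrans[OF pre small_pt_arr[OF sR leg]], unfolded st,
          OF ev[OF oR[OF s]] \<epsilon>] by (simp add: dia_arr)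
  qed
  have "iso_arr ?E (AMap (?ev a) \<epsilon>)" if "a \<in> Obj (rcone S)" for a
    using that base infty by (auto simp: Obj_rcone)
  moreover have "\<epsilon> \<in> Arr ?R" using \<epsilon> by (simp add: Hom_def)
  ultimately have "iso_arr ?R \<epsilon>" using der2 sR unfolding Der2_def by blast
  then show "colimiting_cocone D S X"
    unfolding colimiting_cocone_def isomorphic_def using X iX \<epsilon> unfolding X'_def by blast
qed

end
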